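(* Let $\mathcal H_\mathrm{S},\mathcal H_\mathrm{M},\mathcal H_\mathrm{R}$ be finite-dimensional Hilbert spaces (system, memory, reservoir). Let $\rho^\mathrm{i}_\mathrm{SM}$ be any density operator on $\mathcal H_\mathrm{S}\otimes\mathcal H_\mathrm{M}$, let $\mathcal H_\mathrm{R}$ denote also a Hermitian Hamiltonian on the reservoir space, $\beta>0$, and $\rho^\mathrm{i}_\mathrm{R}=e^{-\beta\mathcal H_\mathrm{R}}/\mathrm{Tr}\,e^{-\beta\mathcal H_\mathrm{R}}$. Let $U_\mathrm{SR}$ be a unitary on $\mathcal H_\mathrm{S}\otimes\mathcal H_\mathrm{R}$, and set $\rho^\mathrm{f}_\mathrm{SMR}=(U_\mathrm{SR}\otimes 1_\mathrm{M})(\rho^\mathrm{i}_\mathrm{SM}\otimes\rho^\mathrm{i}_\mathrm{R})(U_\mathrm{SR}\otimes 1_\mathrm{M})^\dagger$, with all reduced states at times $\mathrm{i}$ and $\mathrm{f}$ obtained by partial traces. Define the heat $Q_\mathrm{R}=\mathrm{Tr}[(\rho^\mathrm{f}_\mathrm{R}-\rho^\mathrm{i}_\mathrm{R})\mathcal H_\mathrm{R}]$, the unconditional entropy production $\Sigma_\mathrm{S}=\mathcal S(\rho^\mathrm{f}_\mathrm{S})-\mathcal S(\rho^\mathrm{i}_\mathrm{S})+\beta Q_\mathrm{R}$ and the conditional entropy production $\Sigma_\mathrm{S|M}=\mathcal S_\mathrm{S|M}(\mathrm f)-\mathcal S_\mathrm{S|M}(\mathrm i)+\beta Q_\mathrm{R}$,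 where $\mathcal S_\mathrm{S|M}=\mathcal S(\rho_\mathrm{SM})-\mathcal S(\rho_\mathrm{M})$ evaluated at the respective time. Then $\Sigma_\mathrm{S|M}\geq\Sigma_\mathrm{S}\geq 0$.
   Context: $\mathcal S(\rho)=-\mathrm{Tr}\,\rho\ln\rho$ is the von Neumann entropy. The memory does not evolve; only system and reservoir interact through $U_\mathrm{SR}$, and initially the reservoir is uncorrelated with system and memory. *)

theory Defs
  imports "Jordan_Normal_Form.Schur_Decomposition"
begin

(* Finite-dimensional Hilbert spaces are modelled as C^n; operators as n x n complex matrices.
   Adjoint (conjugate transpose) is the library's mat_adjoint. *)

definition mtrace :: "complex mat \<Rightarrow> complex" where
  "mtrace A = (\<Sum>i<dim_row A. A $$ (i,i))"

definition hermitian_mat :: "nat \<Rightarrow> complex mat \<Rightarrow> bool" where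
  "hermitian_mat n A \<longleftrightarrow> A \<in> carrier_mat n n \<and> mat_adjoint A = A"

definition unitary_mat :: "nat \<Rightarrow> complex mat \<Rightarrow> bool" where
  "unitary_mat n U \<longleftrightarrow> U \<in> carrier_mat n n \<and> U * mat_adjoint U = 1\<^sub>m n \<and> mat_adjoint U * U = 1\<^sub>m n"

definition density_op :: "nat \<Rightarrow> complex mat \<Rightarrow> bool" where
  "density_op n \<rho> \<longleftrightarrow> hermitian_mat n \<rho>
     \<and> (\<forall>v \<in> carrier_vec n. Im (conjugate v \<bullet> (\<rho> *\<^sub>v v)) = 0 \<and> Re (conjugate v \<bullet> (\<rho> *\<^sub>v v)) \<ge> 0)
     \<and> mtrace \<rho> = 1"

definition mat_fun :: "nat \<Rightarrow> (real \<Rightarrow> real) \<Rightarrow> complex mat \<Rightarrow> complex mat" where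
  "mat_fun n f A = (let (U, l) = (SOME (U, l). unitary_mat n U \<and>
        A = U * mat_diag n (\<lambda>i. complex_of_real (l i)) * mat_adjoint U)
     in U * mat_diag n (\<lambda>i. complex_of_real (f (l i))) * mat_adjoint U)"

(* matrix logarithm (only applied to density operators; on the kernel the value is irrelevant
   since it is multiplied by rho) *)
definition mat_ln :: "nat \<Rightarrow> complex mat \<Rightarrow> complex mat" where
  "mat_ln n A = mat_fun n ln A"

definition vn_entropy :: "nat \<Rightarrow> complex mat \<Rightarrow> real" where
  "vn_entropy n \<rho> = - Re (mtrace (\<rho> * mat_ln n \<rho>))"

definition gibbs_state :: "nat \<Rightarrow> real \<Rightarrow> complex mat \<Rightarrow> complex mat" where
  "gibbs_state n \<beta> H = (let E = mat_fun n (\<lambda>x. exp (- \<beta> * x)) H in (1 / mtrace E) \<cdot>\<^sub>m E)"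

(* tensor (Kronecker) product on C^a (x) C^b, index (i,k) |-> i*b + k *)
definition kron :: "nat \<Rightarrow> nat \<Rightarrow> complex mat \<Rightarrow> complex mat \<Rightarrow> complex mat" where
  "kron a b A B = mat (a*b) (a*b) (\<lambda>(p,q). A $$ (p div b, q div b) * B $$ (p mod b, q mod b))"

definition ptrace2 :: "nat \<Rightarrow> nat \<Rightarrow> complex mat \<Rightarrow> complex mat" where
  "ptrace2 a b \<rho> = mat a a (\<lambda>(i,j). \<Sum>k<b. \<rho> $$ (i*b + k, j*b + k))"

definition ptrace1 :: "nat \<Rightarrow> nat \<Rightarrow> complex mat \<Rightarrow> complex mat" where
  "ptrace1 a b \<rho> = mat b b (\<lambda>(k,l). \<Sum>i<a. \<rho> $$ (i*b + k, i*b + l))"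

(* U_SR (x) 1_M acting on C^dS (x) C^dM (x) C^dR (index (s,m,r) |-> s*dM*dR + m*dR + r),
   where U_SR acts on C^dS (x) C^dR (index (s,r) |-> s*dR + r). *)
definition lift_SR :: "nat \<Rightarrow> nat \<Rightarrow> nat \<Rightarrow> complex mat \<Rightarrow> complex mat" where
  "lift_SR dS dM dR U = mat (dS*dM*dR) (dS*dM*dR) (\<lambda>(p,q).
     let s = p div (dM*dR); m = (p div dR) mod dM; r = p mod dR;
         s' = q div (dM*dR); m' = (q div dR) mod dM; r' = q mod dR
     in if m = m' then U $$ (s*dR + r, s'*dR + r') else 0)"

end

theory Submission
  imports Defs "HOL-Real_Asymp.Real_Asymp"
begin

text \<open>Since the memory does not evolve, the first inequality says that the mutual information of
  system and memory cannot increase. The entropy of the whole is conserved, so this is strong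
  subadditivity for the final state of system, memory and reservoir. The second inequality is
  subadditivity together with the Gibbs variational principle for the reservoir.

  All of these are instances of the monotonicity of the relative entropy under partial traces.
  With eigenvalues \<open>l i\<close> of \<open>\<rho>\<close>, \<open>m j\<close> of \<open>\<sigma>\<close>, and overlaps \<open>w j i\<close> of the eigenvectors, the sum
  of \<open>\<bar>w j i\<bar>\<^sup>2 (l i)\<^sup>2 / (m j + t * l i)\<close> is the supremum over all \<open>X\<close> of
  \<open>2 Re Tr X\<^sup>*\<rho> - Tr X X\<^sup>*\<sigma> - t Tr X\<^sup>*X \<rho>\<close>. Restricting \<open>X\<close> to operators on the first factor turns this
  functional into the one of the reduced operators, so the supremum decreases under a partial trace,
  and integrating over \<open>t\<close> gives the relative entropy.\<close>

subsection \<open>Adjoints, traces and unitary matrices\<close>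

text \<open>The obstacle is that the eigenbases of an operator and of its marginals are unrelated,
  so formulas in eigenvalues cannot be compared directly. The quadratic functional mentions no
  basis, and for fixed X and t it is linear in the pair (rho, sigma); hence it passes exactly to
  partial traces, which are dual to tensoring with the identity. The term x^2 / (m + t x) has the
  integral x (ln (m + T x) - ln m) over t in [0, T]. After removing x ln T, whose total is the trace
  times ln T and so survives a partial trace unchanged, the limit is x (ln x - ln m). For this the
  second operator has to be positive definite. Strong subadditivity takes as second operator the
  system-reservoir marginal tensored with the unnormalised identity on the memory, so that its
  logarithm contributes exactly the entropy of that marginal. Tracing out everything gives
  nonnegativity of the relative entropy, and a one-dimensional first factor in strong subadditivity
  gives subadditivity.\<close>

abbreviation adjoint_mat :: "complex mat \<Rightarrow> complex mat" ("_\<^sup>\<dagger>" [1000] 999) where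
  "A\<^sup>\<dagger> \<equiv> mat_adjoint A"

lemma adjoint_dim [simp]: "dim_row (A\<^sup>\<dagger>) = dim_col A" "dim_col (A\<^sup>\<dagger>) = dim_row A"
  by (simp_all add: mat_adjoint_def)

lemma adjoint_carrier [simp, intro]: "A \<in> carrier_mat m n \<Longrightarrow> A\<^sup>\<dagger> \<in> carrier_mat n m"
  by (rule carrier_matI) simp_all

lemma adjoint_index [simp]:
  "i < dim_col A \<Longrightarrow> j < dim_row A \<Longrightarrow> A\<^sup>\<dagger> $$ (i, j) = cnj (A $$ (j, i))"
  by (simp add: mat_adjoint_def mat_of_rows_index)

lemma adjoint_adjoint [simp]: "(A\<^sup>\<dagger>)\<^sup>\<dagger> = A"
  by (rule eq_matI) auto

lemma adjoint_one [simp]: "(1\<^sub>m n)\<^sup>\<dagger> = 1\<^sub>m n"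
  by (rule eq_matI) auto

lemma adjoint_diag [simp]: "(mat_diag n (\<lambda>i. complex_of_real (f i)))\<^sup>\<dagger> = mat_diag n (\<lambda>i. complex_of_real (f i))"
  by (rule eq_matI) (auto simp: mat_diag_def)

lemma mult_index:
  assumes "A \<in> carrier_mat m n" "B \<in> carrier_mat n p" "i < m" "j < p"
  shows "(A * B) $$ (i, j) = (\<Sum>k<n. A $$ (i, k) * B $$ (k, j))"
  using assms by (auto simp: scalar_prod_def atLeast0LessThan intro!: sum.cong)

lemma adjoint_mult:
  assumes "A \<in> carrier_mat m n" "B \<in> carrier_mat n p"
  shows "(A * B)\<^sup>\<dagger> = B\<^sup>\<dagger> * A\<^sup>\<dagger>"
proof (rule eq_matI)
  fix i j assume "i < dim_row (B\<^sup>\<dagger> * A\<^sup>\<dagger>)" "j < dim_col (B\<^sup>\<dagger> * A\<^sup>\<dagger>)"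
  then have ij: "i < p" "j < m" using assms by auto
  have "(A * B)\<^sup>\<dagger> $$ (i, j) = cnj ((A * B) $$ (j, i))"
    using assms ij by simp
  also have "\<dots> = (\<Sum>k<n. cnj (A $$ (j, k)) * cnj (B $$ (k, i)))"
    by (simp add: mult_index[OF assms ij(2) ij(1)] cnj_sum)
  also have "\<dots> = (B\<^sup>\<dagger> * A\<^sup>\<dagger>) $$ (i, j)"
    using assms ij
    by (subst mult_index[OF adjoint_carrier[OF assms(2)] adjoint_carrier[OF assms(1)]])
       (auto intro!: sum.cong)
  finally show "(A * B)\<^sup>\<dagger> $$ (i, j) = (B\<^sup>\<dagger> * A\<^sup>\<dagger>) $$ (i, j)" .
qed (use assms in auto)

lemma mtrace_mult:
  assumes "A \<in> carrier_mat m n" "B \<in> carrier_mat n m"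
  shows "mtrace (A * B) = (\<Sum>i<m. \<Sum>k<n. A $$ (i, k) * B $$ (k, i))"
  using assms by (simp add: mtrace_def mult_index[OF assms] del: index_mult_mat(1))

lemma mtrace_comm:
  assumes "A \<in> carrier_mat m n" "B \<in> carrier_mat n m"
  shows "mtrace (A * B) = mtrace (B * A)"
  unfolding mtrace_mult[OF assms] mtrace_mult[OF assms(2,1)]
  by (subst sum.swap) (simp add: mult.commute)

lemma mtrace_add:
  assumes "A \<in> carrier_mat n n" "B \<in> carrier_mat n n"
  shows "mtrace (A + B) = mtrace A + mtrace B"
  using assms by (auto simp: mtrace_def sum.distrib)

lemma mtrace_minus:
  assumes "A \<in> carrier_mat n n" "B \<in> carrier_mat n n"
  shows "mtrace (A - B) = mtrace A - mtrace B"
  using assms by (auto simp: mtrace_def sum_subtractf)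

lemma mtrace_smult:
  assumes "A \<in> carrier_mat n n"
  shows "mtrace (c \<cdot>\<^sub>m A) = c * mtrace A"
  using assms by (auto simp: mtrace_def sum_distrib_left)

lemma mtrace_one [simp]: "mtrace (1\<^sub>m n) = of_nat n"
  by (simp add: mtrace_def)

lemma mtrace_diag [simp]: "mtrace (mat_diag n f) = (\<Sum>i<n. f i)"
  by (simp add: mtrace_def mat_diag_def)

text \<open>The trace pairing is nondegenerate: a matrix unit as \<open>X\<close> picks out a single
  entry. Identities between partial traces are proved through it, because their pairings are known
  by duality.\<close>

lemma mat_eq_by_trace:
  assumes A: "A \<in> carrier_mat n n" and B: "B \<in> carrier_mat n n"
    and eq: "\<And>X. X \<in> carrier_mat n n \<Longrightarrow> mtrace (X * A) = mtrace (X * B)"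
  shows "A = B"
proof (rule eq_matI)
  fix i j assume "i < dim_row B" "j < dim_col B"
  then have ij: "i < n" "j < n" using B by auto
  define X :: "complex mat" where "X = mat n n (\<lambda>(p, q). if p = j \<and> q = i then 1 else 0)"
  have X: "X \<in> carrier_mat n n" by (simp add: X_def)
  have *: "mtrace (X * C) = C $$ (i, j)" if "C \<in> carrier_mat n n" for C
  proof -
    have "mtrace (X * C) = (\<Sum>p<n. \<Sum>q<n. if p = j \<and> q = i then C $$ (q, p) else 0)"
      unfolding mtrace_mult[OF X that] by (intro sum.cong refl) (auto simp: X_def)
    also have "\<dots> = (\<Sum>p<n. if p = j then C $$ (i, p) else 0)"
      by (intro sum.cong refl) (use ij in auto)
    finally show ?thesis using ij by simp
  qed
  show "A $$ (i, j) = B $$ (i, j)" using eq[OF X] *[OF A] *[OF B] by simp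
qed (use A B in auto)

lemma unitary_carrier: "unitary_mat n U \<Longrightarrow> U \<in> carrier_mat n n"
  by (simp add: unitary_mat_def)

lemma unitary_one [simp]: "unitary_mat n (1\<^sub>m n)"
  by (simp add: unitary_mat_def)

lemma unitary_adjoint: "unitary_mat n U \<Longrightarrow> unitary_mat n (U\<^sup>\<dagger>)"
  by (simp add: unitary_mat_def)

text \<open>The products are nested to the right because \<open>assoc_square\<close> brings products
  into that form; the simplifier can then cancel inside long products.\<close>

lemma unitary_cancel:
  assumes "unitary_mat n U" "A \<in> carrier_mat n n"
  shows "U * (U\<^sup>\<dagger> * A) = A" "U\<^sup>\<dagger> * (U * A) = A"
  using assms assoc_mult_mat[of U n n "U\<^sup>\<dagger>" n A n] assoc_mult_mat[of "U\<^sup>\<dagger>" n n U n A n]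
  by (auto simp: unitary_mat_def)

lemma assoc_square:
  fixes A B C :: "complex mat"
  assumes "A \<in> carrier_mat n n" "B \<in> carrier_mat n n" "C \<in> carrier_mat n n"
  shows "(A * B) * C = A * (B * C)"
  using assms by (rule assoc_mult_mat)

lemma mult_square:
  fixes A B :: "complex mat"
  assumes "A \<in> carrier_mat n n" "B \<in> carrier_mat n n"
  shows "A * B \<in> carrier_mat n n"
  using assms by (rule mult_carrier_mat)

lemma unitary_mult:
  assumes "unitary_mat n U" "unitary_mat n V"
  shows "unitary_mat n (U * V)"
proof -
  have c: "U \<in> carrier_mat n n" "V \<in> carrier_mat n n" "U\<^sup>\<dagger> \<in> carrier_mat n n" "V\<^sup>\<dagger> \<in> carrier_mat n n"
    using assms by (auto simp: unitary_mat_def)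
  have "U * V * (U * V)\<^sup>\<dagger> = 1\<^sub>m n"
    using c assms unitary_cancel[OF assms(2) c(3)]
    by (simp add: adjoint_mult[OF c(1,2)] assoc_square[of _ n] mult_square[of _ n] unitary_mat_def)
  moreover have "(U * V)\<^sup>\<dagger> * (U * V) = 1\<^sub>m n"
    using c assms unitary_cancel[OF assms(1) c(2)]
    by (simp add: adjoint_mult[OF c(1,2)] assoc_square[of _ n] mult_square[of _ n] unitary_mat_def)
  ultimately show ?thesis using c by (simp add: unitary_mat_def)
qed

lemma mtrace_unitary_conj:
  assumes U: "unitary_mat n U" and A: "A \<in> carrier_mat n n"
  shows "mtrace (U * A * U\<^sup>\<dagger>) = mtrace A"
proof -
  have c: "U \<in> carrier_mat n n" using U by (simp add: unitary_mat_def)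
  have "mtrace (U * A * U\<^sup>\<dagger>) = mtrace (U\<^sup>\<dagger> * (U * A))"
    by (rule mtrace_comm) (use c A in auto)
  then show ?thesis by (simp add: unitary_cancel[OF U A])
qed

subsection \<open>The spectral theorem\<close>

text \<open>The condition is the one under which \<open>mat_fun\<close> selects its pair, so the
  selected pair is a diagonalization in this sense.\<close>

definition diagonalizes :: "nat \<Rightarrow> complex mat \<Rightarrow> complex mat \<Rightarrow> (nat \<Rightarrow> real) \<Rightarrow> bool" where
  "diagonalizes n A U l \<longleftrightarrow> unitary_mat n U
     \<and> A = U * mat_diag n (\<lambda>i. complex_of_real (l i)) * U\<^sup>\<dagger>"

definition direct_sum1 :: "nat \<Rightarrow> complex \<Rightarrow> complex mat \<Rightarrow> complex mat" where
  "direct_sum1 n x A = mat (Suc n) (Suc n)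
     (\<lambda>(i, j). if i = 0 then if j = 0 then x else 0 else if j = 0 then 0 else A $$ (i - 1, j - 1))"

lemma direct_sum1_carrier [simp]: "direct_sum1 n x A \<in> carrier_mat (Suc n) (Suc n)"
  by (simp add: direct_sum1_def)

lemma direct_sum1_mult:
  assumes "A \<in> carrier_mat n n" "B \<in> carrier_mat n n"
  shows "direct_sum1 n x A * direct_sum1 n y B = direct_sum1 n (x * y) (A * B)"
proof (rule eq_matI)
  fix i j assume "i < dim_row (direct_sum1 n (x * y) (A * B))" "j < dim_col (direct_sum1 n (x * y) (A * B))"
  then have ij: "i < Suc n" "j < Suc n" by (auto simp: direct_sum1_def)
  have "(direct_sum1 n x A * direct_sum1 n y B) $$ (i, j)
      = (\<Sum>k<Suc n. direct_sum1 n x A $$ (i, k) * direct_sum1 n y B $$ (k, j))"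
    by (rule mult_index) (use ij in auto)
  also have "\<dots> = direct_sum1 n (x * y) (A * B) $$ (i, j)"
    using ij
    by (cases i; cases j)
       (auto simp: sum.lessThan_Suc_shift direct_sum1_def mult_index[OF assms] simp del: sum.lessThan_Suc index_mult_mat(1))
  finally show "(direct_sum1 n x A * direct_sum1 n y B) $$ (i, j) = direct_sum1 n (x * y) (A * B) $$ (i, j)" .
qed (auto simp: direct_sum1_def)

lemma direct_sum1_adjoint:
  assumes "A \<in> carrier_mat n n"
  shows "(direct_sum1 n x A)\<^sup>\<dagger> = direct_sum1 n (cnj x) (A\<^sup>\<dagger>)"
  by (rule eq_matI) (use assms in \<open>auto simp: direct_sum1_def\<close>)

lemma direct_sum1_one: "direct_sum1 n 1 (1\<^sub>m n) = 1\<^sub>m (Suc n)"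
  by (rule eq_matI) (auto simp: direct_sum1_def)

lemma direct_sum1_diag: "direct_sum1 n (complex_of_real x) (mat_diag n (\<lambda>i. complex_of_real (f i)))
    = mat_diag (Suc n) (\<lambda>i. complex_of_real (case_nat x f i))"
  by (rule eq_matI) (auto simp: direct_sum1_def mat_diag_def split: nat.splits)

text \<open>The vector is completed to a basis and orthogonalised by Gram-Schmidt, which keeps the
  first vector but does not normalise; dividing each column by its length makes the matrix unitary.
  The factor \<open>c\<close> is the reciprocal length of \<open>v\<close>.\<close>

lemma unitary_with_first_column:
  assumes v: "v \<in> carrier_vec n" and v0: "v \<noteq> 0\<^sub>v n"
  obtains W c where "unitary_mat n W" "\<And>i. i < n \<Longrightarrow> W $$ (i, 0) = c * (v $ i)"
proof -
  interpret cof_vec_space n "TYPE(complex)" .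
  define b where "b = basis_completion v"
  define ws where "ws = gram_schmidt n b"
  define W where "W = mat_of_cols n ws"
  note bc = basis_completion[OF v v0, folded b_def]
  have n: "n \<noteq> 0" using v v0 by (metis carrier_vecD eq_vecI index_zero_vec(2) less_nat_zero_code)
  obtain vs where bv: "b = v # vs" using bc n by (cases b) auto
  from gram_schmidt_result[OF bc(2,4,5) refl, folded ws_def] bc
  have ws: "set ws \<subseteq> carrier_vec n" "corthogonal ws" "length ws = n" by auto
  have hd: "hd ws = v" using gram_schmidt_hd[OF v, of vs, folded bv] unfolding ws_def .
  have orth: "corthogonal_mat W" using orthogonal_mat_of_cols ws unfolding W_def by auto
  have W: "W \<in> carrier_mat n n" unfolding W_def using ws by auto
  have G: "(W\<^sup>\<dagger> * W) $$ (i, j) = (\<Sum>k<n. cnj (W $$ (k, i)) * W $$ (k, j))" if "i < n" "j < n" for i j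
    by (subst mult_index[of _ n n _ n]) (use W that in \<open>auto intro!: sum.cong\<close>)
  define N where "N j = (\<Sum>k<n. (cmod (W $$ (k, j)))\<^sup>2)" for j
  have GN: "(W\<^sup>\<dagger> * W) $$ (j, j) = complex_of_real (N j)" if "j < n" for j
    unfolding G[OF that that] N_def of_real_sum
    by (intro sum.cong refl) (metis complex_norm_square mult.commute of_real_power)
  have G0: "(W\<^sup>\<dagger> * W) $$ (i, j) = 0" if "i < n" "j < n" "i \<noteq> j" for i j
    using orth W that by (auto simp: corthogonal_mat_def diagonal_mat_def Let_def)
  have "N j \<noteq> 0" if "j < n" for j
    using orth W that GN[OF that] by (auto simp: corthogonal_mat_def Let_def)
  moreover have "N j \<ge> 0" for j unfolding N_def by (intro sum_nonneg) auto
  ultimately have N: "N j > 0" if "j < n" for j using that by (metis less_eq_real_def)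
  define V where "V = mat n n (\<lambda>(i, j). W $$ (i, j) / complex_of_real (sqrt (N j)))"
  have V: "V \<in> carrier_mat n n" by (simp add: V_def)
  have VV: "V\<^sup>\<dagger> * V = 1\<^sub>m n"
  proof (rule eq_matI)
    fix i j assume "i < dim_row (1\<^sub>m n :: complex mat)" "j < dim_col (1\<^sub>m n :: complex mat)"
    then have ij: "i < n" "j < n" by auto
    have "(V\<^sup>\<dagger> * V) $$ (i, j) = (\<Sum>k<n. V\<^sup>\<dagger> $$ (i, k) * V $$ (k, j))"
      by (rule mult_index) (use V ij in auto)
    also have "\<dots> = (\<Sum>k<n. cnj (W $$ (k, i)) * W $$ (k, j) /
        (complex_of_real (sqrt (N i)) * complex_of_real (sqrt (N j))))"
      by (intro sum.cong refl) (use ij in \<open>auto simp: V_def\<close>)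
    also have "\<dots> = (W\<^sup>\<dagger> * W) $$ (i, j) / (complex_of_real (sqrt (N i)) * complex_of_real (sqrt (N j)))"
      by (simp only: G[OF ij] sum_divide_distrib)
    also have "\<dots> = 1\<^sub>m n $$ (i, j)"
    proof (cases "i = j")
      case True
      have "complex_of_real (sqrt (N j)) * complex_of_real (sqrt (N j)) = complex_of_real (N j)"
        using N[OF ij(2)] by (simp flip: of_real_mult)
      then show ?thesis using True GN[OF ij(2)] N[OF ij(2)] ij by simp
    next
      case False
      then show ?thesis using G0[OF ij False] ij by simp
    qed
    finally show "(V\<^sup>\<dagger> * V) $$ (i, j) = 1\<^sub>m n $$ (i, j)" .
  qed (use V in auto)
  have "V * V\<^sup>\<dagger> = 1\<^sub>m n" using mat_mult_left_right_inverse[of "V\<^sup>\<dagger>" n V] V VV by auto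
  then have "unitary_mat n V" using V VV by (simp add: unitary_mat_def)
  moreover have "V $$ (i, 0) = (1 / complex_of_real (sqrt (N 0))) * (v $ i)" if "i < n" for i
  proof -
    have "ws ! 0 = v" using hd ws n by (metis hd_conv_nth length_0_conv)
    then have "W $$ (i, 0) = v $ i" using that n ws by (simp add: W_def mat_of_cols_index)
    then show ?thesis using that n by (simp add: V_def)
  qed
  ultimately show ?thesis using that by blast
qed

text \<open>The characteristic polynomial splits into linear factors over the complex numbers, and
  there is at least one because its degree \<open>n\<close> is positive.\<close>

lemma eigenvector_exists:
  assumes A: "A \<in> carrier_mat n n" and n: "n \<noteq> 0"
  obtains v e where "v \<in> carrier_vec n" "v \<noteq> 0\<^sub>v n" "A *\<^sub>v v = e \<cdot>\<^sub>v (v :: complex vec)"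
proof -
  obtain as where cp: "char_poly A = (\<Prod>a\<leftarrow>as. [:- a, 1:])" and len: "length as = n"
    using char_poly_factorized[OF A] by blast
  obtain e es where "as = e # es" using len n by (cases as) auto
  then have "eigenvalue A e" unfolding eigenvalue_root_char_poly[OF A] cp by simp
  then show ?thesis using that A unfolding eigenvalue_def eigenvector_def by auto
qed

text \<open>Deflation: in an orthonormal basis that starts with an eigenvector, the first column
  vanishes below the corner. The matrix stays Hermitian, so the first row vanishes as well, and
  induction applies to the remaining block.\<close>

theorem spectral_theorem:
  assumes "hermitian_mat n A"
  obtains U l where "diagonalizes n A U l"
proof -
  have "\<exists>U l. diagonalizes n A U l"
    using assms
  proof (induction n arbitrary: A)
    case 0
    have "diagonalizes 0 A (1\<^sub>m 0) (\<lambda>_. 0)"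
      using 0 by (auto simp: diagonalizes_def hermitian_mat_def intro!: eq_matI)
    then show ?case by blast
  next
    case (Suc n)
    have A: "A \<in> carrier_mat (Suc n) (Suc n)" and herm: "A\<^sup>\<dagger> = A"
      using Suc.prems by (auto simp: hermitian_mat_def)
    obtain v e where v: "v \<in> carrier_vec (Suc n)" "v \<noteq> 0\<^sub>v (Suc n)" and ev: "A *\<^sub>v v = e \<cdot>\<^sub>v v"
      using eigenvector_exists[OF A] by blast
    obtain W c where W: "unitary_mat (Suc n) W" and W0: "\<And>i. i < Suc n \<Longrightarrow> W $$ (i, 0) = c * (v $ i)"
      using unitary_with_first_column[OF v] by blast
    have Wc: "W \<in> carrier_mat (Suc n) (Suc n)" using W by (simp add: unitary_mat_def)
    have Wd: "W\<^sup>\<dagger> \<in> carrier_mat (Suc n) (Suc n)" using Wc by blast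
    define B where "B = W\<^sup>\<dagger> * (A * W)"
    have B: "B \<in> carrier_mat (Suc n) (Suc n)" unfolding B_def using A Wc Wd by auto
    have Bh: "B\<^sup>\<dagger> = B"
      unfolding B_def
      using A Wc Wd by (simp add: adjoint_mult[OF Wd mult_carrier_mat[OF A Wc]] adjoint_mult[OF A Wc] herm
        assoc_square[of _ "Suc n"])
    have AW: "(A * W) $$ (k, 0) = e * W $$ (k, 0)" if "k < Suc n" for k
    proof -
      have "(A * W) $$ (k, 0) = (\<Sum>i<Suc n. A $$ (k, i) * W $$ (i, 0))"
        by (rule mult_index[OF A Wc]) (use that in auto)
      also have "\<dots> = (\<Sum>i<Suc n. A $$ (k, i) * (c * (v $ i)))"
        by (intro sum.cong refl) (use W0 in auto)
      also have "\<dots> = c * (\<Sum>i<Suc n. A $$ (k, i) * v $ i)"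
        by (simp add: sum_distrib_left algebra_simps del: sum.lessThan_Suc)
      also have "(\<Sum>i<Suc n. A $$ (k, i) * v $ i) = (A *\<^sub>v v) $ k"
        using A v(1) that by (auto simp: scalar_prod_def atLeast0LessThan intro!: sum.cong simp del: sum.lessThan_Suc)
      also have "\<dots> = e * v $ k" using ev v(1) that by simp
      finally show ?thesis using W0[OF that] by simp
    qed
    have Bi0: "B $$ (i, 0) = (if i = 0 then e else 0)" if i: "i < Suc n" for i
    proof -
      have "B $$ (i, 0) = (\<Sum>k<Suc n. W\<^sup>\<dagger> $$ (i, k) * (A * W) $$ (k, 0))"
        unfolding B_def by (rule mult_index[OF Wd mult_carrier_mat[OF A Wc]]) (use i in auto)
      also have "\<dots> = (\<Sum>k<Suc n. e * (W\<^sup>\<dagger> $$ (i, k) * W $$ (k, 0)))"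
        by (intro sum.cong refl) (simp add: AW algebra_simps del: index_mult_mat(1))
      also have "\<dots> = e * (W\<^sup>\<dagger> * W) $$ (i, 0)"
        by (subst mult_index[OF Wd Wc]) (use i in \<open>auto simp: sum_distrib_left simp del: sum.lessThan_Suc\<close>)
      also have "\<dots> = (if i = 0 then e else 0)" using W i by (simp add: unitary_mat_def)
      finally show ?thesis .
    qed
    have B_cnj: "B $$ (i, j) = cnj (B $$ (j, i))" if "i < Suc n" "j < Suc n" for i j
      using Bh B that by (metis adjoint_index carrier_matD)
    \<comment> \<open>The eigenvalue is the corner entry of the Hermitian matrix \<open>B\<close>,
      hence real, as \<open>diagonalizes\<close> demands.\<close>
    have e: "e = complex_of_real (Re e)"
      using B_cnj[of 0 0] Bi0[of 0] by (simp add: complex_eq_iff)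
    have B0j: "B $$ (0, j) = (if j = 0 then e else 0)" if "j < Suc n" for j
      using B_cnj[of 0 j] Bi0[OF that] that Bi0[of 0] by (auto split: if_splits)
    define C where "C = mat n n (\<lambda>(i, j). B $$ (Suc i, Suc j))"
    have BC: "B = direct_sum1 n e C"
      by (rule eq_matI) (use B Bi0 B0j in \<open>auto simp: direct_sum1_def C_def\<close>)
    have "C\<^sup>\<dagger> = C"
      by (rule eq_matI) (simp_all add: C_def B_cnj[symmetric])
    then have "hermitian_mat n C"
      by (simp add: hermitian_mat_def C_def)
    then obtain U l where Ul: "unitary_mat n U" "C = U * mat_diag n (\<lambda>i. complex_of_real (l i)) * U\<^sup>\<dagger>"
      using Suc.IH unfolding diagonalizes_def by blast
    have U: "U \<in> carrier_mat n n" "U\<^sup>\<dagger> \<in> carrier_mat n n" using Ul by (auto simp: unitary_mat_def)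
    define V where "V = direct_sum1 n 1 U"
    have V: "V \<in> carrier_mat (Suc n) (Suc n)" "V\<^sup>\<dagger> \<in> carrier_mat (Suc n) (Suc n)"
      by (auto simp: V_def)
    have Vd: "V\<^sup>\<dagger> = direct_sum1 n 1 (U\<^sup>\<dagger>)" unfolding V_def by (simp add: direct_sum1_adjoint[OF U(1)])
    have uV: "unitary_mat (Suc n) V"
      using Ul(1) V U unfolding unitary_mat_def Vd
      by (auto simp: V_def direct_sum1_mult direct_sum1_one)
    define D where "D = mat_diag (Suc n) (\<lambda>i. complex_of_real (case_nat (Re e) l i))"
    have D: "D \<in> carrier_mat (Suc n) (Suc n)" by (simp add: D_def)
    have BV: "B = V * D * V\<^sup>\<dagger>"
    proof -
      have "V * D = direct_sum1 n e (U * mat_diag n (\<lambda>i. complex_of_real (l i)))"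
        unfolding V_def D_def direct_sum1_diag[symmetric]
        by (subst direct_sum1_mult) (use U e in auto)
      then show ?thesis unfolding Vd BC Ul(2)
        by (simp add: direct_sum1_mult[OF mult_carrier_mat[OF U(1) mat_diag_dim] U(2)])
    qed
    have "A = W * B * W\<^sup>\<dagger>"
      unfolding B_def using A Wc Wd W
      by (simp add: assoc_square[of _ "Suc n"] mult_square[of _ "Suc n"] unitary_cancel unitary_mat_def)
    also have "\<dots> = (W * V) * D * (W * V)\<^sup>\<dagger>"
      unfolding BV using Wc Wd V D
      by (simp add: adjoint_mult[OF Wc V(1)] assoc_square[of _ "Suc n"] mult_square[of _ "Suc n"])
    finally have "diagonalizes (Suc n) A (W * V) (case_nat (Re e) l)"
      using unitary_mult[OF W uV] by (simp add: diagonalizes_def D_def)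
    then show ?case by blast
  qed
  then show ?thesis using that by blast
qed

lemma diagonalizes_carrier:
  assumes "diagonalizes n A U l"
  shows "U \<in> carrier_mat n n" "U\<^sup>\<dagger> \<in> carrier_mat n n" "A \<in> carrier_mat n n" "unitary_mat n U"
  using assms by (auto simp: diagonalizes_def unitary_mat_def intro!: mult_carrier_mat[of _ n n])

lemma diagonalizes_hermitian:
  assumes "diagonalizes n A U l"
  shows "hermitian_mat n A"
proof -
  have c: "U \<in> carrier_mat n n" "U\<^sup>\<dagger> \<in> carrier_mat n n" using diagonalizes_carrier[OF assms] by auto
  show ?thesis
    using assms c unfolding diagonalizes_def hermitian_mat_def
    by (auto simp: adjoint_mult[of _ n n _ n] mult_square[of _ n] assoc_square[of _ n])
qed

text \<open>The choice made by \<open>SOME\<close> does not matter. If two diagonalizations are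
  related by \<open>W = V\<^sup>\<dagger> * U\<close>, then \<open>W\<close> intertwines the
  diagonal matrices, so an entry of \<open>W\<close> can be nonzero only where the two eigenvalues
  agree; there \<open>f\<close> agrees too, and \<open>W\<close> also intertwines the images under
  \<open>f\<close>.\<close>

lemma mat_fun_eq:
  assumes d: "diagonalizes n A U l"
  shows "mat_fun n f A = U * mat_diag n (\<lambda>i. complex_of_real (f (l i))) * U\<^sup>\<dagger>"
proof -
  define D where "D g = mat_diag n (\<lambda>i. complex_of_real (g i))" for g
  have D [simp]: "D g \<in> carrier_mat n n" for g by (simp add: D_def)
  obtain V m where Vm: "(SOME (U, l). unitary_mat n U \<and> A = U * mat_diag n (\<lambda>i. complex_of_real (l i)) * U\<^sup>\<dagger>) = (V, m)"
    by fastforce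
  have "case (V, m) of (U, l) \<Rightarrow> unitary_mat n U \<and> A = U * mat_diag n (\<lambda>i. complex_of_real (l i)) * U\<^sup>\<dagger>"
    unfolding Vm[symmetric]
    by (rule someI[of "\<lambda>(U, l). unitary_mat n U \<and> A = U * mat_diag n (\<lambda>i. complex_of_real (l i)) * U\<^sup>\<dagger>" "(U, l)"])
       (use d in \<open>simp add: diagonalizes_def\<close>)
  then have uV: "unitary_mat n V" and AV: "A = V * D m * V\<^sup>\<dagger>" by (auto simp: D_def)
  have uU: "unitary_mat n U" and AU: "A = U * D l * U\<^sup>\<dagger>" using d by (auto simp: diagonalizes_def D_def)
  have c [simp]: "U \<in> carrier_mat n n" "U\<^sup>\<dagger> \<in> carrier_mat n n" "V \<in> carrier_mat n n" "V\<^sup>\<dagger> \<in> carrier_mat n n"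
    using uU uV by (auto simp: unitary_mat_def)
  note s = assoc_square[of _ n] mult_square[of _ n] unitary_cancel[OF uU] unitary_cancel[OF uV]
    right_mult_one_mat[of _ n n]
  define W where "W = V\<^sup>\<dagger> * U"
  have W [simp]: "W \<in> carrier_mat n n" by (simp add: W_def s)
  have "D m * W = V\<^sup>\<dagger> * (V * D m * V\<^sup>\<dagger>) * U" by (simp add: W_def s)
  also have "\<dots> = V\<^sup>\<dagger> * (U * D l * U\<^sup>\<dagger>) * U" using AV AU by simp
  also have "\<dots> = W * D l" using uU by (simp add: W_def s unitary_mat_def)
  finally have WD: "D m * W = W * D l" .
  have "D (\<lambda>i. f (m i)) * W = W * D (\<lambda>i. f (l i))"
  proof (rule eq_matI)
    fix i j assume "i < dim_row (W * D (\<lambda>i. f (l i)))" "j < dim_col (W * D (\<lambda>i. f (l i)))"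
    then have ij: "i < n" "j < n" using W D by (auto simp del: W D simp: D_def mat_diag_def W_def)
    have "(D m * W) $$ (i, j) = (W * D l) $$ (i, j)" using WD by simp
    then have "complex_of_real (m i) * W $$ (i, j) = complex_of_real (l j) * W $$ (i, j)"
      unfolding D_def mat_diag_mult_left[OF W] mat_diag_mult_right[OF W] using ij by simp
    then have "m i = l j \<or> W $$ (i, j) = 0" by auto
    then show "(D (\<lambda>i. f (m i)) * W) $$ (i, j) = (W * D (\<lambda>i. f (l i))) $$ (i, j)"
      unfolding D_def mat_diag_mult_left[OF W] mat_diag_mult_right[OF W] using ij by auto
  qed (insert carrier_matD[OF c(1)] carrier_matD[OF c(3)], auto simp: D_def mat_diag_def W_def)
  then have "V * (D (\<lambda>i. f (m i)) * W) * U\<^sup>\<dagger> = V * (W * D (\<lambda>i. f (l i))) * U\<^sup>\<dagger>" by simp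
  then have "V * D (\<lambda>i. f (m i)) * V\<^sup>\<dagger> = U * D (\<lambda>i. f (l i)) * U\<^sup>\<dagger>"
    using uU by (simp add: W_def s unitary_mat_def)
  then show ?thesis by (simp add: mat_fun_def Vm D_def)
qed

lemma mat_ln_eq:
  assumes "diagonalizes n A U l"
  shows "mat_ln n A = U * mat_diag n (\<lambda>i. complex_of_real (ln (l i))) * U\<^sup>\<dagger>"
  unfolding mat_ln_def by (rule mat_fun_eq[OF assms])

text \<open>A zero eigenvalue contributes 0 through its factor \<open>l i\<close>, whatever
  \<open>ln 0\<close> is; this realises the usual convention 0 ln 0 = 0.\<close>

lemma vn_entropy_eq:
  assumes d: "diagonalizes n A U l"
  shows "vn_entropy n A = - (\<Sum>i<n. l i * ln (l i))"
proof -
  note c = diagonalizes_carrier[OF d]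
  have "A * mat_ln n A = U * mat_diag n (\<lambda>i. complex_of_real (l i * ln (l i))) * U\<^sup>\<dagger>"
    unfolding mat_ln_eq[OF d]
    apply (subst (1) conjunct2[OF d[unfolded diagonalizes_def]])
    using c by (simp add: assoc_square[of _ n] mult_square[of _ n] unitary_cancel
        flip: assoc_square[of "mat_diag n _" n "mat_diag n _"])
  then have "mtrace (A * mat_ln n A) = complex_of_real (\<Sum>i<n. l i * ln (l i))"
    using mtrace_unitary_conj[OF c(4)] by simp
  then show ?thesis by (simp add: vn_entropy_def)
qed

subsection \<open>Tensor products and partial traces\<close>

lemma div_mod_less_mult:
  fixes p :: nat
  assumes "p < a * b"
  shows "p div b < a" "p mod b < b" "p = p div b * b + p mod b"
proof -
  have "0 < b" using assms by (metis gr0I mult_0_right not_less0)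
  then show "p div b < a" "p mod b < b" using assms by (simp_all add: less_mult_imp_div_less)
qed simp

lemma mult_add_less: "i < a \<Longrightarrow> k < b \<Longrightarrow> i * b + k < a * (b::nat)"
proof -
  assume "i < a" "k < b"
  then have "i * b + k < Suc i * b" by simp
  also have "\<dots> \<le> a * b" using \<open>i < a\<close> by (intro mult_right_mono) auto
  finally show ?thesis .
qed

lemma sum_mult_index:
  fixes f :: "nat \<Rightarrow> 'a::comm_monoid_add"
  shows "(\<Sum>p<a * b. f p) = (\<Sum>i<a. \<Sum>k<b. f (i * b + k))"
proof -
  have "(\<Sum>k<b. f (i * b + k)) = sum f {i * b..<i * b + b}" for i
    using sum.shift_bounds_nat_ivl[of f 0 "i * b" b] by (simp add: atLeast0LessThan add.commute)
  then show ?thesis using sum.nat_group[of f b a] by simp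
qed

text \<open>Writing every index as \<open>i * b + k\<close> from the start keeps \<open>div\<close>
  and \<open>mod\<close> out of the tensor calculations.\<close>

lemma eq_mat_product:
  assumes "A \<in> carrier_mat (a * b) (a * b)" "B \<in> carrier_mat (a * b) (a * b)"
    and "\<And>i k j l. i < a \<Longrightarrow> k < b \<Longrightarrow> j < a \<Longrightarrow> l < b \<Longrightarrow>
      A $$ (i * b + k, j * b + l) = B $$ (i * b + k, j * b + l)"
  shows "A = B"
proof (rule eq_matI)
  fix p q assume "p < dim_row B" "q < dim_col B"
  then have pq: "p < a * b" "q < a * b" using assms by auto
  show "A $$ (p, q) = B $$ (p, q)"
    using assms(3)[OF div_mod_less_mult(1,2)[OF pq(1)] div_mod_less_mult(1,2)[OF pq(2)]] by simp
qed (use assms in auto)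

section \<open>Two factors: Kronecker products and their partial traces\<close>

lemma kron_carrier [simp]: "kron a b A B \<in> carrier_mat (a * b) (a * b)"
  by (simp add: kron_def)

lemma kron_dim [simp]: "dim_row (kron a b A B) = a * b" "dim_col (kron a b A B) = a * b"
  by (simp_all add: kron_def)

lemma ptrace2_carrier [simp]: "ptrace2 a b \<rho> \<in> carrier_mat a a"
  by (simp add: ptrace2_def)

lemma ptrace1_carrier [simp]: "ptrace1 a b \<rho> \<in> carrier_mat b b"
  by (simp add: ptrace1_def)

lemma kron_index [simp]:
  "i < a \<Longrightarrow> k < b \<Longrightarrow> j < a \<Longrightarrow> l < b \<Longrightarrow>
    kron a b A B $$ (i * b + k, j * b + l) = A $$ (i, j) * B $$ (k, l)"
  by (simp add: kron_def mult_add_less)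

lemma kron_mult:
  assumes "A \<in> carrier_mat a a" "B \<in> carrier_mat b b" "C \<in> carrier_mat a a" "D \<in> carrier_mat b b"
  shows "kron a b A B * kron a b C D = kron a b (A * C) (B * D)"
proof (rule eq_mat_product)
  fix i k j l assume ij: "i < a" "k < b" "j < a" "l < b"
  have "(kron a b A B * kron a b C D) $$ (i * b + k, j * b + l)
      = (\<Sum>p<a * b. kron a b A B $$ (i * b + k, p) * kron a b C D $$ (p, j * b + l))"
    by (rule mult_index[OF kron_carrier kron_carrier]) (use ij in \<open>auto intro: mult_add_less\<close>)
  also have "\<dots> = (\<Sum>p<a. \<Sum>q<b. (A $$ (i, p) * C $$ (p, j)) * (B $$ (k, q) * D $$ (q, l)))"
    unfolding sum_mult_index by (intro sum.cong refl) (use ij in auto)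
  also have "\<dots> = (A * C) $$ (i, j) * (B * D) $$ (k, l)"
    by (simp only: mult_index[OF assms(1,3) ij(1,3)] mult_index[OF assms(2,4) ij(2,4)] sum_product)
  finally show "(kron a b A B * kron a b C D) $$ (i * b + k, j * b + l)
      = kron a b (A * C) (B * D) $$ (i * b + k, j * b + l)" using ij by simp
qed (auto intro: mult_square)

lemma kron_adjoint:
  assumes "A \<in> carrier_mat a a" "B \<in> carrier_mat b b"
  shows "(kron a b A B)\<^sup>\<dagger> = kron a b (A\<^sup>\<dagger>) (B\<^sup>\<dagger>)"
proof (rule eq_mat_product)
  fix i k j l assume ij: "i < a" "k < b" "j < a" "l < b"
  then have "(kron a b A B)\<^sup>\<dagger> $$ (i * b + k, j * b + l) = cnj (kron a b A B $$ (j * b + l, i * b + k))"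
    by (subst adjoint_index) (auto simp: kron_def mult_add_less)
  then show "(kron a b A B)\<^sup>\<dagger> $$ (i * b + k, j * b + l) = kron a b (A\<^sup>\<dagger>) (B\<^sup>\<dagger>) $$ (i * b + k, j * b + l)"
    using ij assms by simp
qed auto

lemma prod_index_eq_iff:
  assumes "k < b" "l < (b::nat)"
  shows "i * b + k = j * b + l \<longleftrightarrow> i = j \<and> k = l"
  using assms by (metis add.commute add_right_cancel div_mult_self1 div_less mod_mult_self1 mod_less
      add_0 gr_implies_not0 mult.commute)

lemma kron_diag: "kron a b (mat_diag a f) (mat_diag b g) = mat_diag (a * b) (\<lambda>p. f (p div b) * g (p mod b))"
proof (rule eq_mat_product)
  fix i k j l assume ij: "i < a" "k < b" "j < a" "l < b"
  then show "kron a b (mat_diag a f) (mat_diag b g) $$ (i * b + k, j * b + l)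
      = mat_diag (a * b) (\<lambda>p. f (p div b) * g (p mod b)) $$ (i * b + k, j * b + l)"
    by (simp add: mat_diag_def prod_index_eq_iff mult_add_less)
qed auto

lemma kron_one: "kron a b (1\<^sub>m a) (1\<^sub>m b) = 1\<^sub>m (a * b)"
  using kron_diag[of a b "\<lambda>_. 1" "\<lambda>_. 1"] by simp

lemma unitary_kron:
  assumes "unitary_mat a U" "unitary_mat b V"
  shows "unitary_mat (a * b) (kron a b U V)"
  using assms by (auto simp: unitary_mat_def kron_adjoint kron_mult kron_one)

text \<open>The partial trace is the dual of tensoring with the identity. Through this duality,
  lower bounds and the quadratic functional pass to marginals.\<close>

lemma mtrace_ptrace2:
  assumes "X \<in> carrier_mat a a" "\<rho> \<in> carrier_mat (a * b) (a * b)"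
  shows "mtrace (kron a b X (1\<^sub>m b) * \<rho>) = mtrace (X * ptrace2 a b \<rho>)"
proof -
  have "mtrace (kron a b X (1\<^sub>m b) * \<rho>)
      = (\<Sum>i<a. \<Sum>k<b. \<Sum>j<a. \<Sum>l<b. kron a b X (1\<^sub>m b) $$ (i * b + k, j * b + l) * \<rho> $$ (j * b + l, i * b + k))"
    by (simp only: mtrace_mult[OF kron_carrier assms(2)] sum_mult_index)
  also have "\<dots> = (\<Sum>i<a. \<Sum>k<b. \<Sum>j<a. \<Sum>l<b. if l = k then X $$ (i, j) * \<rho> $$ (j * b + l, i * b + k) else 0)"
    by (intro sum.cong refl) auto
  also have "\<dots> = (\<Sum>i<a. \<Sum>j<a. \<Sum>k<b. X $$ (i, j) * \<rho> $$ (j * b + k, i * b + k))"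
    by (subst (2) sum.swap) (auto intro!: sum.cong)
  also have "\<dots> = mtrace (X * ptrace2 a b \<rho>)"
    unfolding mtrace_mult[OF assms(1) ptrace2_carrier]
    by (intro sum.cong refl) (simp add: ptrace2_def sum_distrib_left)
  finally show ?thesis .
qed

lemma mtrace_ptrace1:
  assumes "Y \<in> carrier_mat b b" "\<rho> \<in> carrier_mat (a * b) (a * b)"
  shows "mtrace (kron a b (1\<^sub>m a) Y * \<rho>) = mtrace (Y * ptrace1 a b \<rho>)"
proof -
  have "mtrace (kron a b (1\<^sub>m a) Y * \<rho>)
      = (\<Sum>i<a. \<Sum>k<b. \<Sum>j<a. \<Sum>l<b. kron a b (1\<^sub>m a) Y $$ (i * b + k, j * b + l) * \<rho> $$ (j * b + l, i * b + k))"
    by (simp only: mtrace_mult[OF kron_carrier assms(2)] sum_mult_index)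
  also have "\<dots> = (\<Sum>i<a. \<Sum>k<b. \<Sum>j<a. if j = i then (\<Sum>l<b. Y $$ (k, l) * \<rho> $$ (j * b + l, i * b + k)) else 0)"
    by (intro sum.cong refl) auto
  also have "\<dots> = (\<Sum>i<a. \<Sum>k<b. \<Sum>l<b. Y $$ (k, l) * \<rho> $$ (i * b + l, i * b + k))"
    by (rule sum.cong[OF refl], rule sum.cong[OF refl]) simp
  also have "\<dots> = (\<Sum>k<b. \<Sum>l<b. \<Sum>i<a. Y $$ (k, l) * \<rho> $$ (i * b + l, i * b + k))"
    by (rule trans[OF sum.swap], rule sum.cong[OF refl], rule sum.swap)
  also have "\<dots> = mtrace (Y * ptrace1 a b \<rho>)"
    unfolding mtrace_mult[OF assms(1) ptrace1_carrier]
    by (intro sum.cong refl) (simp add: ptrace1_def sum_distrib_left)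
  finally show ?thesis .
qed

lemma mtrace_kron:
  assumes "A \<in> carrier_mat a a" "B \<in> carrier_mat b b"
  shows "mtrace (kron a b A B) = mtrace A * mtrace B"
  using assms
  by (simp add: mtrace_def kron_def sum_mult_index sum_product mult_add_less[of _ a])

lemma ptrace2_kron:
  assumes "A \<in> carrier_mat a a" "B \<in> carrier_mat b b"
  shows "ptrace2 a b (kron a b A B) = mtrace B \<cdot>\<^sub>m A"
  by (rule eq_matI) (use assms in \<open>auto simp: ptrace2_def mtrace_def sum_distrib_left mult.commute\<close>)

lemma ptrace2_one: "ptrace2 a b (1\<^sub>m (a * b)) = of_nat b \<cdot>\<^sub>m 1\<^sub>m a"
  unfolding kron_one[symmetric] by (subst ptrace2_kron) auto

lemma mtrace_ptrace2_one:
  assumes "\<rho> \<in> carrier_mat (a * b) (a * b)"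
  shows "mtrace (ptrace2 a b \<rho>) = mtrace \<rho>"
  using mtrace_ptrace2[of "1\<^sub>m a" a \<rho> b] left_mult_one_mat[OF ptrace2_carrier] assms by (simp add: kron_one)

lemma ptrace2_adjoint:
  assumes "\<rho> \<in> carrier_mat (a * b) (a * b)"
  shows "(ptrace2 a b \<rho>)\<^sup>\<dagger> = ptrace2 a b (\<rho>\<^sup>\<dagger>)"
  by (rule eq_matI) (use assms in \<open>auto simp: ptrace2_def mult_add_less\<close>)

text \<open>With the ordering system, memory, reservoir, \<open>ptrace_mid\<close> traces out the memory.\<close>

definition ptrace_mid :: "nat \<Rightarrow> nat \<Rightarrow> nat \<Rightarrow> complex mat \<Rightarrow> complex mat" where
  "ptrace_mid a m b \<rho> = mat (a * b) (a * b)
     (\<lambda>(p, q). \<Sum>k<m. \<rho> $$ ((p div b * m + k) * b + p mod b, (q div b * m + k) * b + q mod b))"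

lemma ptrace_mid_carrier [simp]: "ptrace_mid a m b \<rho> \<in> carrier_mat (a * b) (a * b)"
  by (simp add: ptrace_mid_def)

lemma ptrace_mid_index [simp]:
  "i < a \<Longrightarrow> k < b \<Longrightarrow> j < a \<Longrightarrow> l < b \<Longrightarrow>
    ptrace_mid a m b \<rho> $$ (i * b + k, j * b + l) = (\<Sum>h<m. \<rho> $$ ((i * m + h) * b + k, (j * m + h) * b + l))"
  by (simp add: ptrace_mid_def mult_add_less)

section \<open>Three factors: operators that act trivially on the memory\<close>

lemma lift_SR_carrier [simp]: "lift_SR a m b U \<in> carrier_mat (a * m * b) (a * m * b)"
  by (simp add: lift_SR_def)

text \<open>The nested index equals \<open>i * (m * b) + h * b + k\<close>, the number that
  \<open>lift_SR\<close> decodes. Hence the grouping used by \<open>kron (a * m) b\<close> and the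
  one used by \<open>lift_SR\<close> are the same indexing.\<close>

lemma lift_SR_index [simp]:
  assumes "i < a" "h < m" "k < b" "i' < a" "h' < m" "k' < b"
  shows "lift_SR a m b U $$ ((i * m + h) * b + k, (i' * m + h') * b + k')
    = (if h = h' then U $$ (i * b + k, i' * b + k') else 0)"
proof -
  have "((i * m + h) * b + k) div (m * b) = i" if "h < m" "k < b" for i h k
    using that by (metis add.commute div_mult2_eq div_mult_self1 div_less add_0 mult.commute gr_implies_not0)
  moreover have "((i * m + h) * b + k) div b mod m = h" "((i * m + h) * b + k) mod b = k" if "h < m" "k < b" for i h k
    using that by simp_all
  ultimately show ?thesis
    using assms by (simp add: lift_SR_def mult_add_less Let_def)
qed

lemma eq_mat_product3:
  assumes "A \<in> carrier_mat (a * m * b) (a * m * b)" "B \<in> carrier_mat (a * m * b) (a * m * b)"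
    and "\<And>i h k i' h' k'. i < a \<Longrightarrow> h < m \<Longrightarrow> k < b \<Longrightarrow> i' < a \<Longrightarrow> h' < m \<Longrightarrow> k' < b \<Longrightarrow>
      A $$ ((i * m + h) * b + k, (i' * m + h') * b + k') = B $$ ((i * m + h) * b + k, (i' * m + h') * b + k')"
  shows "A = B"
proof (rule eq_mat_product[OF assms(1,2)])
  fix p k q l assume pq: "p < a * m" "k < b" "q < a * m" "l < b"
  show "A $$ (p * b + k, q * b + l) = B $$ (p * b + k, q * b + l)"
    using assms(3)[OF div_mod_less_mult(1,2)[OF pq(1)] pq(2) div_mod_less_mult(1,2)[OF pq(3)] pq(4)] by simp
qed

lemma lift_SR_mult:
  assumes "A \<in> carrier_mat (a * b) (a * b)" "B \<in> carrier_mat (a * b) (a * b)"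
  shows "lift_SR a m b A * lift_SR a m b B = lift_SR a m b (A * B)"
proof (rule eq_mat_product3)
  fix i h k i' h' k'
  assume ij: "i < a" "h < m" "k < b" "i' < a" "h' < m" "k' < b"
  have lt: "i * b + k < a * b" "i' * b + k' < a * b" using ij by (auto intro: mult_add_less)
  have "(lift_SR a m b A * lift_SR a m b B) $$ ((i * m + h) * b + k, (i' * m + h') * b + k')
      = (\<Sum>p<a*m*b. lift_SR a m b A $$ ((i * m + h) * b + k, p) * lift_SR a m b B $$ (p, (i' * m + h') * b + k'))"
    by (rule mult_index[OF lift_SR_carrier lift_SR_carrier]) (use ij in \<open>auto intro!: mult_add_less\<close>)
  also have "\<dots> = (\<Sum>p<a. \<Sum>q<m. \<Sum>r<b. (if h = q then A $$ (i * b + k, p * b + r) else 0)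
      * (if q = h' then B $$ (p * b + r, i' * b + k') else 0))"
    unfolding sum_mult_index by (intro sum.cong refl) (use ij in auto)
  also have "\<dots> = (\<Sum>p<a. \<Sum>q<m. if q = h then if h = h' then
      \<Sum>r<b. A $$ (i * b + k, p * b + r) * B $$ (p * b + r, i' * b + k') else 0 else 0)"
    by (intro sum.cong refl) auto
  also have "\<dots> = (if h = h' then (A * B) $$ (i * b + k, i' * b + k') else 0)"
    unfolding mult_index[OF assms lt] sum_mult_index using ij by auto
  finally show "(lift_SR a m b A * lift_SR a m b B) $$ ((i * m + h) * b + k, (i' * m + h') * b + k')
    = lift_SR a m b (A * B) $$ ((i * m + h) * b + k, (i' * m + h') * b + k')" using ij by simp
qed (auto intro: mult_square)

lemma lift_SR_adjoint:
  assumes "A \<in> carrier_mat (a * b) (a * b)"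
  shows "(lift_SR a m b A)\<^sup>\<dagger> = lift_SR a m b (A\<^sup>\<dagger>)"
proof (rule eq_mat_product3)
  fix i h k i' h' k'
  assume ij: "i < a" "h < m" "k < b" "i' < a" "h' < m" "k' < b"
  have "(lift_SR a m b A)\<^sup>\<dagger> $$ ((i * m + h) * b + k, (i' * m + h') * b + k')
      = cnj (lift_SR a m b A $$ ((i' * m + h') * b + k', (i * m + h) * b + k))"
    by (rule adjoint_index) (use ij in \<open>auto simp: lift_SR_def intro!: mult_add_less\<close>)
  then show "(lift_SR a m b A)\<^sup>\<dagger> $$ ((i * m + h) * b + k, (i' * m + h') * b + k')
      = lift_SR a m b (A\<^sup>\<dagger>) $$ ((i * m + h) * b + k, (i' * m + h') * b + k')"
    using ij assms by (simp add: mult_add_less)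
qed auto

text \<open>For \<open>p = (i * m + h) * b + k\<close> the argument of \<open>f\<close> is
  \<open>i * b + k\<close>: the memory coordinate is forgotten.\<close>

lemma lift_SR_diag:
  "lift_SR a m b (mat_diag (a * b) f) = mat_diag (a * m * b) (\<lambda>p. f (p div b div m * b + p mod b))"
proof (rule eq_mat_product3)
  fix i h k i' h' k'
  assume ij: "i < a" "h < m" "k < b" "i' < a" "h' < m" "k' < b"
  have "i * m + h < a * m" "i' * m + h' < a * m" using ij by (auto intro: mult_add_less)
  then show "lift_SR a m b (mat_diag (a * b) f) $$ ((i * m + h) * b + k, (i' * m + h') * b + k')
      = mat_diag (a * m * b) (\<lambda>p. f (p div b div m * b + p mod b)) $$ ((i * m + h) * b + k, (i' * m + h') * b + k')"
    using ij by (auto simp: mat_diag_def prod_index_eq_iff mult_add_less)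
qed auto

lemma lift_SR_one: "lift_SR a m b (1\<^sub>m (a * b)) = 1\<^sub>m (a * m * b)"
  using lift_SR_diag[of a m b "\<lambda>_. 1"] by simp

lemma unitary_lift_SR:
  assumes "unitary_mat (a * b) U"
  shows "unitary_mat (a * m * b) (lift_SR a m b U)"
  using assms by (auto simp: unitary_mat_def lift_SR_adjoint lift_SR_mult lift_SR_one)

text \<open>The same duality as for \<open>ptrace2\<close>, now with \<open>lift_SR\<close> as the
  embedding; it allows the middle factor to be traced out without permuting the factors.\<close>

lemma mtrace_ptrace_mid:
  assumes "X \<in> carrier_mat (a * b) (a * b)" "\<rho> \<in> carrier_mat (a * m * b) (a * m * b)"
  shows "mtrace (lift_SR a m b X * \<rho>) = mtrace (X * ptrace_mid a m b \<rho>)"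
proof -
  have "mtrace (lift_SR a m b X * \<rho>)
      = (\<Sum>i<a. \<Sum>h<m. \<Sum>k<b. \<Sum>i'<a. \<Sum>h'<m. \<Sum>k'<b.
          lift_SR a m b X $$ ((i * m + h) * b + k, (i' * m + h') * b + k') * \<rho> $$ ((i' * m + h') * b + k', (i * m + h) * b + k))"
    by (simp only: mtrace_mult[OF lift_SR_carrier assms(2)] sum_mult_index)
  also have "\<dots> = (\<Sum>i<a. \<Sum>h<m. \<Sum>k<b. \<Sum>i'<a. \<Sum>h'<m. if h' = h then \<Sum>k'<b.
          X $$ (i * b + k, i' * b + k') * \<rho> $$ ((i' * m + h') * b + k', (i * m + h) * b + k) else 0)"
    by (intro sum.cong refl) auto
  also have "\<dots> = (\<Sum>i<a. \<Sum>h<m. \<Sum>k<b. \<Sum>i'<a. \<Sum>k'<b.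
          X $$ (i * b + k, i' * b + k') * \<rho> $$ ((i' * m + h) * b + k', (i * m + h) * b + k))"
    by (rule sum.cong[OF refl], rule sum.cong[OF refl], rule sum.cong[OF refl], rule sum.cong[OF refl]) simp
  also have "\<dots> = (\<Sum>i<a. \<Sum>k<b. \<Sum>i'<a. \<Sum>k'<b. \<Sum>h<m.
          X $$ (i * b + k, i' * b + k') * \<rho> $$ ((i' * m + h) * b + k', (i * m + h) * b + k))"
    by (rule sum.cong[OF refl], rule trans[OF sum.swap], rule sum.cong[OF refl],
        rule trans[OF sum.swap], rule sum.cong[OF refl], rule sum.swap)
  also have "\<dots> = mtrace (X * ptrace_mid a m b \<rho>)"
    unfolding mtrace_mult[OF assms(1) ptrace_mid_carrier] sum_mult_index
    by (intro sum.cong refl) (simp add: sum_distrib_left)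
  finally show ?thesis .
qed

lemma ptrace_mid_adjoint:
  assumes "\<rho> \<in> carrier_mat (a * m * b) (a * m * b)"
  shows "(ptrace_mid a m b \<rho>)\<^sup>\<dagger> = ptrace_mid a m b (\<rho>\<^sup>\<dagger>)"
proof (rule eq_mat_product)
  fix i k j l assume ij: "i < a" "k < b" "j < a" "l < b"
  have "(ptrace_mid a m b \<rho>)\<^sup>\<dagger> $$ (i * b + k, j * b + l) = cnj (ptrace_mid a m b \<rho> $$ (j * b + l, i * b + k))"
    by (rule adjoint_index) (use ij in \<open>auto simp: ptrace_mid_def intro!: mult_add_less\<close>)
  then show "(ptrace_mid a m b \<rho>)\<^sup>\<dagger> $$ (i * b + k, j * b + l) = ptrace_mid a m b (\<rho>\<^sup>\<dagger>) $$ (i * b + k, j * b + l)"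
    using ij assms by (simp add: mult_add_less)
qed auto

section \<open>Iterated marginals, and marginals of the evolved state\<close>

lemma kron_kron_one: "kron (a * m) b (kron a m X (1\<^sub>m m)) Y = lift_SR a m b (kron a b X Y)"
  by (rule eq_mat_product3[of _ a m b]) (auto simp: mult_add_less)

lemma kron_one_one: "kron (a * m) b (1\<^sub>m (a * m)) Y = lift_SR a m b (kron a b (1\<^sub>m a) Y)"
  unfolding kron_one[of a m, symmetric] by (rule kron_kron_one)

text \<open>Tested against \<open>X\<close>, both sides become the trace of \<open>\<rho>\<close>
  times X tensored with the identity on the other two factors; \<open>kron_kron_one\<close>
  identifies the two groupings of that operator.\<close>

lemma ptrace2_ptrace2:
  assumes \<rho>: "\<rho> \<in> carrier_mat (a * m * b) (a * m * b)"
  shows "ptrace2 a m (ptrace2 (a * m) b \<rho>) = ptrace2 a b (ptrace_mid a m b \<rho>)"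
proof (rule mat_eq_by_trace)
  fix X :: "complex mat" assume X: "X \<in> carrier_mat a a"
  show "mtrace (X * ptrace2 a m (ptrace2 (a * m) b \<rho>)) = mtrace (X * ptrace2 a b (ptrace_mid a m b \<rho>))"
    by (simp add: \<rho> X kron_kron_one flip: mtrace_ptrace2 mtrace_ptrace_mid)
qed auto

lemma ptrace1_ptrace_mid:
  assumes \<rho>: "\<rho> \<in> carrier_mat (a * m * b) (a * m * b)"
  shows "ptrace1 (a * m) b \<rho> = ptrace1 a b (ptrace_mid a m b \<rho>)"
proof (rule mat_eq_by_trace)
  fix X :: "complex mat" assume X: "X \<in> carrier_mat b b"
  show "mtrace (X * ptrace1 (a * m) b \<rho>) = mtrace (X * ptrace1 a b (ptrace_mid a m b \<rho>))"
    by (simp add: \<rho> X kron_one_one flip: mtrace_ptrace1 mtrace_ptrace_mid)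
qed auto

lemma ptrace_mid_kron:
  "ptrace_mid a m b (kron (a * m) b A B) = kron a b (ptrace2 a m A) B"
  by (rule eq_mat_product[of _ a b]) (auto simp: mult_add_less ptrace2_def sum_distrib_right)

lemma ptrace2_lift_SR: "ptrace2 (a * m) b (lift_SR a m b X) = kron a m (ptrace2 a b X) (1\<^sub>m m)"
  by (rule eq_mat_product[of _ a m]) (auto simp: mult_add_less ptrace2_def)

text \<open>In the dual picture the observable evolves: by cyclicity the conjugation moves onto the
  lifted \<open>X\<close>, and since lifting respects products the result is the lift of
  \<open>U\<^sup>\<dagger> * X * U\<close>. Without the memory, the state therefore evolves by
  \<open>U\<close> alone.\<close>

lemma lift_SR_conj_ptrace_mid:
  assumes U: "U \<in> carrier_mat (a * b) (a * b)" and \<rho>: "\<rho> \<in> carrier_mat (a * m * b) (a * m * b)"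
  shows "ptrace_mid a m b (lift_SR a m b U * \<rho> * (lift_SR a m b U)\<^sup>\<dagger>) = U * ptrace_mid a m b \<rho> * U\<^sup>\<dagger>"
proof (rule mat_eq_by_trace)
  let ?L = "lift_SR a m b"
  let ?N = "a * m * b" and ?n = "a * b"
  note s = assoc_square[of _ ?N] mult_square[of _ ?N]
  note t = assoc_square[of _ ?n] mult_square[of _ ?n]
  fix X :: "complex mat" assume X: "X \<in> carrier_mat (a * b) (a * b)"
  have Ud: "U\<^sup>\<dagger> \<in> carrier_mat (a * b) (a * b)" using U by simp
  have "mtrace (X * ptrace_mid a m b (?L U * \<rho> * (?L U)\<^sup>\<dagger>)) = mtrace (?L X * (?L U * \<rho> * (?L U)\<^sup>\<dagger>))"
    by (rule mtrace_ptrace_mid[symmetric, OF X]) (simp add: s \<rho>)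
  also have "\<dots> = mtrace ((?L X * ?L U * \<rho>) * ?L (U\<^sup>\<dagger>))"
    using U by (simp add: s \<rho> lift_SR_adjoint)
  also have "\<dots> = mtrace (?L (U\<^sup>\<dagger>) * (?L X * ?L U * \<rho>))"
    by (rule mtrace_comm[of _ ?N ?N]) (simp_all add: s \<rho>)
  also have "\<dots> = mtrace (?L (U\<^sup>\<dagger>) * ?L X * ?L U * \<rho>)"
    by (simp add: s \<rho>)
  also have "\<dots> = mtrace (?L (U\<^sup>\<dagger> * X * U) * \<rho>)"
    using U Ud X by (simp add: lift_SR_mult t)
  also have "\<dots> = mtrace (U\<^sup>\<dagger> * X * U * ptrace_mid a m b \<rho>)"
    by (rule mtrace_ptrace_mid) (simp_all add: t U Ud X \<rho>)
  also have "\<dots> = mtrace (U\<^sup>\<dagger> * (X * U * ptrace_mid a m b \<rho>))"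
    by (simp add: t U Ud X)
  also have "\<dots> = mtrace ((X * U * ptrace_mid a m b \<rho>) * U\<^sup>\<dagger>)"
    by (rule mtrace_comm[of _ ?n ?n]) (simp_all add: t U Ud X)
  also have "\<dots> = mtrace (X * (U * ptrace_mid a m b \<rho> * U\<^sup>\<dagger>))"
    by (simp add: t U Ud X)
  finally show "mtrace (X * ptrace_mid a m b (?L U * \<rho> * (?L U)\<^sup>\<dagger>)) = mtrace (X * (U * ptrace_mid a m b \<rho> * U\<^sup>\<dagger>))" .
qed (use U in \<open>auto intro!: mult_carrier_mat[of _ "a*b" "a*b"]\<close>)

lemma lift_SR_commute:
  assumes "U \<in> carrier_mat (a * b) (a * b)"
  shows "lift_SR a m b U * kron (a * m) b (kron a m (1\<^sub>m a) Y) (1\<^sub>m b)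
    = kron (a * m) b (kron a m (1\<^sub>m a) Y) (1\<^sub>m b) * lift_SR a m b U" (is "?L * ?K = ?K * ?L")
proof (rule eq_mat_product3)
  fix i h k i' h' k'
  assume ij: "i < a" "h < m" "k < b" "i' < a" "h' < m" "k' < b"
  let ?p = "(i * m + h) * b + k" and ?q = "(i' * m + h') * b + k'"
  have p: "?p < a * m * b" "?q < a * m * b" using ij by (auto intro!: mult_add_less)
  have "(?L * ?K) $$ (?p, ?q) = (\<Sum>r<a*m*b. ?L $$ (?p, r) * ?K $$ (r, ?q))"
    by (rule mult_index[OF lift_SR_carrier kron_carrier]) (use p in auto)
  also have "\<dots> = (\<Sum>x<a. \<Sum>y<m. \<Sum>z<b. if z = k' then if y = h then if x = i' then
      U $$ (i * b + k, x * b + z) * Y $$ (y, h') else 0 else 0 else 0)"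
    unfolding sum_mult_index by (intro sum.cong refl) (use ij in \<open>auto simp: mult_add_less\<close>)
  \<comment> \<open>A single term survives in each order: x = i', y = h, z = k' in the first sum,
    and x = i, y = h', z = k in the second. Both give the same product.\<close>
  also have "\<dots> = U $$ (i * b + k, i' * b + k') * Y $$ (h, h')"
    using ij by simp
  also have "\<dots> = (\<Sum>x<a. \<Sum>y<m. \<Sum>z<b. if z = k then if y = h' then if x = i then
      Y $$ (h, y) * U $$ (x * b + z, i' * b + k') else 0 else 0 else 0)"
    using ij by simp
  also have "\<dots> = (\<Sum>r<a*m*b. ?K $$ (?p, r) * ?L $$ (r, ?q))"
    unfolding sum_mult_index by (intro sum.cong refl) (use ij in \<open>auto simp: mult_add_less\<close>)
  also have "\<dots> = (?K * ?L) $$ (?p, ?q)"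
    by (rule mult_index[symmetric, OF kron_carrier lift_SR_carrier]) (use p in auto)
  finally show "(?L * ?K) $$ (?p, ?q) = (?K * ?L) $$ (?p, ?q)" .
qed (auto intro: mult_square)

text \<open>An observable of the memory commutes with the lifted unitary, since they act on
  different factors; so its expectation is unchanged, and these expectations determine the memory
  state.\<close>

lemma ptrace_memory_invariant:
  assumes U: "unitary_mat (a * b) U" and \<rho>: "\<rho> \<in> carrier_mat (a * m * b) (a * m * b)"
  shows "ptrace1 a m (ptrace2 (a * m) b (lift_SR a m b U * \<rho> * (lift_SR a m b U)\<^sup>\<dagger>))
    = ptrace1 a m (ptrace2 (a * m) b \<rho>)"
proof (rule mat_eq_by_trace)
  let ?N = "a * m * b"
  let ?L = "lift_SR a m b U"
  have uL: "unitary_mat ?N ?L" by (rule unitary_lift_SR[OF U])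
  note s = assoc_square[of _ ?N] mult_square[of _ ?N]
  fix Y :: "complex mat" assume Y: "Y \<in> carrier_mat m m"
  define K where "K = kron (a * m) b (kron a m (1\<^sub>m a) Y) (1\<^sub>m b)"
  have K: "K \<in> carrier_mat ?N ?N" by (simp add: K_def)
  have *: "mtrace (Y * ptrace1 a m (ptrace2 (a * m) b \<sigma>)) = mtrace (K * \<sigma>)" if "\<sigma> \<in> carrier_mat ?N ?N" for \<sigma>
    using that by (simp add: K_def Y mtrace_ptrace2 mtrace_ptrace1)
  have "mtrace (K * (?L * \<rho> * ?L\<^sup>\<dagger>)) = mtrace ((K * ?L) * \<rho> * ?L\<^sup>\<dagger>)"
    by (simp add: s K \<rho>)
  also have "K * ?L = ?L * K"
    unfolding K_def using U by (simp add: lift_SR_commute unitary_mat_def)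
  also have "mtrace (?L * K * \<rho> * ?L\<^sup>\<dagger>) = mtrace (?L * (K * \<rho>) * ?L\<^sup>\<dagger>)"
    by (simp add: s K \<rho>)
  also have "\<dots> = mtrace (K * \<rho>)"
    by (rule mtrace_unitary_conj[OF uL]) (simp add: s K \<rho>)
  finally show "mtrace (Y * ptrace1 a m (ptrace2 (a * m) b (?L * \<rho> * ?L\<^sup>\<dagger>)))
      = mtrace (Y * ptrace1 a m (ptrace2 (a * m) b \<rho>))"
    by (subst (1 2) *) (simp_all add: s \<rho>)
qed auto

subsection \<open>Traces in eigenbases\<close>

lemma mtrace_sandwich:
  assumes Z: "Z \<in> carrier_mat n n"
  shows "mtrace (Z\<^sup>\<dagger> * mat_diag n (\<lambda>i. complex_of_real (g i)) * Z * mat_diag n (\<lambda>i. complex_of_real (f i)))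
    = complex_of_real (\<Sum>i<n. \<Sum>j<n. f i * g j * (cmod (Z $$ (j, i)))\<^sup>2)"
proof -
  let ?F = "mat_diag n (\<lambda>i. complex_of_real (f i))" and ?G = "mat_diag n (\<lambda>i. complex_of_real (g i))"
  have Zd: "Z\<^sup>\<dagger> \<in> carrier_mat n n" using Z by simp
  have GZF: "?G * Z * ?F \<in> carrier_mat n n" using Z by (simp add: mult_square[of _ n])
  have "mtrace (Z\<^sup>\<dagger> * ?G * Z * ?F) = mtrace (Z\<^sup>\<dagger> * (?G * Z * ?F))"
    using Z Zd by (simp add: assoc_square[of _ n] mult_square[of _ n])
  also have "\<dots> = (\<Sum>i<n. \<Sum>j<n. Z\<^sup>\<dagger> $$ (i, j) * (?G * Z * ?F) $$ (j, i))"
    by (rule mtrace_mult[OF Zd GZF])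
  also have "\<dots> = (\<Sum>i<n. \<Sum>j<n. complex_of_real (f i * g j * (cmod (Z $$ (j, i)))\<^sup>2))"
  proof (intro sum.cong refl)
    fix i j assume "i \<in> {..<n}" "j \<in> {..<n}"
    then have ij: "i < n" "j < n" by auto
    have "(?G * Z * ?F) $$ (j, i) = g j * Z $$ (j, i) * f i"
      using ij Z by (simp add: mat_diag_mult_left[OF Z] mat_diag_mult_right[of _ n])
    moreover have "Z\<^sup>\<dagger> $$ (i, j) = cnj (Z $$ (j, i))" using Z ij by simp
    ultimately show "Z\<^sup>\<dagger> $$ (i, j) * (?G * Z * ?F) $$ (j, i) = complex_of_real (f i * g j * (cmod (Z $$ (j, i)))\<^sup>2)"
      by (simp add: complex_norm_square[unfolded of_real_power] algebra_simps)
  qed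
  finally show ?thesis by simp
qed

text \<open>The matrix \<open>V\<^sup>\<dagger> * X * U\<close> expresses X with its two indices in
  two different bases. With eigenbases of sigma and rho there, both quadratic terms of the later
  functional are diagonal in the same coordinates.\<close>

lemma mtrace_form:
  assumes A: "diagonalizes n A V m" and U: "unitary_mat n U" and X: "X \<in> carrier_mat n n"
  shows "mtrace (X * X\<^sup>\<dagger> * A) = complex_of_real (\<Sum>i<n. \<Sum>j<n. m j * (cmod ((V\<^sup>\<dagger> * X * U) $$ (j, i)))\<^sup>2)"
proof -
  let ?Y = "V\<^sup>\<dagger> * X * U" and ?M = "mat_diag n (\<lambda>i. complex_of_real (m i))"
  note V = diagonalizes_carrier[OF A]
  have c: "U \<in> carrier_mat n n" "U\<^sup>\<dagger> \<in> carrier_mat n n" "X\<^sup>\<dagger> \<in> carrier_mat n n"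
    using U X by (auto simp: unitary_mat_def)
  note s = assoc_square[of _ n] mult_square[of _ n] adjoint_mult[of _ n n _ n]
  have Y: "?Y \<in> carrier_mat n n" using V c X by (simp add: s)
  have AV: "A = V * ?M * V\<^sup>\<dagger>" using A by (simp add: diagonalizes_def)
  have "mtrace (X * X\<^sup>\<dagger> * A) = mtrace (X * (X\<^sup>\<dagger> * A))" using X V c by (simp add: s)
  also have "\<dots> = mtrace ((X\<^sup>\<dagger> * A) * X)" by (rule mtrace_comm[of _ n n]) (use X V c in \<open>auto simp: s\<close>)
  also have "\<dots> = mtrace (U\<^sup>\<dagger> * (X\<^sup>\<dagger> * A * X) * (U\<^sup>\<dagger>)\<^sup>\<dagger>)"
    by (rule mtrace_unitary_conj[symmetric, OF unitary_adjoint[OF U]]) (use X V c in \<open>auto simp: s\<close>)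
  also have "\<dots> = mtrace (?Y\<^sup>\<dagger> * ?M * ?Y * mat_diag n (\<lambda>i. complex_of_real 1))"
    unfolding AV using X V c by (simp add: s right_mult_one_mat[of _ n n])
  also have "\<dots> = complex_of_real (\<Sum>i<n. \<Sum>j<n. m j * (cmod (?Y $$ (j, i)))\<^sup>2)"
    using mtrace_sandwich[OF Y, of m "\<lambda>_. 1"] by simp
  finally show ?thesis .
qed

text \<open>This is \<open>mtrace_form\<close> for the adjoint of \<open>X\<close>, with the two
  bases exchanged.\<close>

lemma mtrace_form':
  assumes A: "diagonalizes n A U l" and V: "unitary_mat n V" and X: "X \<in> carrier_mat n n"
  shows "mtrace (X\<^sup>\<dagger> * X * A) = complex_of_real (\<Sum>i<n. \<Sum>j<n. l i * (cmod ((V\<^sup>\<dagger> * X * U) $$ (j, i)))\<^sup>2)"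
proof -
  note U = diagonalizes_carrier[OF A]
  have c: "V \<in> carrier_mat n n" "V\<^sup>\<dagger> \<in> carrier_mat n n" "X\<^sup>\<dagger> \<in> carrier_mat n n"
    using V X by (auto simp: unitary_mat_def)
  let ?Y = "V\<^sup>\<dagger> * X * U"
  have Y: "?Y \<in> carrier_mat n n" using U c X by (simp add: mult_square[of _ n])
  have Yd: "U\<^sup>\<dagger> * X\<^sup>\<dagger> * V = ?Y\<^sup>\<dagger>"
    using U c X by (simp add: assoc_square[of _ n] mult_square[of _ n] adjoint_mult[of _ n n _ n])
  have "mtrace (X\<^sup>\<dagger> * X * A) = complex_of_real (\<Sum>j<n. \<Sum>i<n. l i * (cmod (?Y\<^sup>\<dagger> $$ (i, j)))\<^sup>2)"
    using mtrace_form[OF A V c(3)] unfolding Yd by simp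
  also have "(\<Sum>j<n. \<Sum>i<n. l i * (cmod (?Y\<^sup>\<dagger> $$ (i, j)))\<^sup>2) = (\<Sum>j<n. \<Sum>i<n. l i * (cmod (?Y $$ (j, i)))\<^sup>2)"
    by (intro sum.cong refl) (use carrier_matD[OF Y] in \<open>simp del: index_mult_mat\<close>)
  finally show ?thesis by (subst sum.swap)
qed

lemma mtrace_pairing:
  assumes A: "diagonalizes n A U l" and V: "unitary_mat n V" and X: "X \<in> carrier_mat n n"
  shows "mtrace (X\<^sup>\<dagger> * A) = (\<Sum>i<n. \<Sum>j<n. cnj ((V\<^sup>\<dagger> * X * U) $$ (j, i)) * ((V\<^sup>\<dagger> * U) $$ (j, i) * l i))"
proof -
  let ?L = "mat_diag n (\<lambda>i. complex_of_real (l i))"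
  note U = diagonalizes_carrier[OF A]
  have c: "V \<in> carrier_mat n n" "V\<^sup>\<dagger> \<in> carrier_mat n n" "X\<^sup>\<dagger> \<in> carrier_mat n n"
    using V X by (auto simp: unitary_mat_def)
  note s = assoc_square[of _ n] mult_square[of _ n] adjoint_mult[of _ n n _ n]
  let ?Y = "V\<^sup>\<dagger> * X * U" and ?W = "V\<^sup>\<dagger> * U"
  have Y: "?Y \<in> carrier_mat n n" and W: "?W \<in> carrier_mat n n" using U c X by (auto simp: s)
  have AU: "A = U * ?L * U\<^sup>\<dagger>" using A by (simp add: diagonalizes_def)
  have "mtrace (?Y\<^sup>\<dagger> * (?W * ?L)) = mtrace (U * (?Y\<^sup>\<dagger> * (?W * ?L)) * U\<^sup>\<dagger>)"
    by (rule mtrace_unitary_conj[symmetric, OF U(4)]) (use Y W in \<open>auto simp: mult_square[of _ n]\<close>)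
  also have "U * (?Y\<^sup>\<dagger> * (?W * ?L)) * U\<^sup>\<dagger> = X\<^sup>\<dagger> * A"
    unfolding AU using U c X by (simp add: s unitary_cancel[OF V] unitary_cancel[OF U(4)])
  finally have "mtrace (X\<^sup>\<dagger> * A) = mtrace (?Y\<^sup>\<dagger> * (?W * ?L))" ..
  also have "\<dots> = (\<Sum>i<n. \<Sum>j<n. ?Y\<^sup>\<dagger> $$ (i, j) * (?W * ?L) $$ (j, i))"
    by (rule mtrace_mult) (use Y W in \<open>auto simp: mult_square[of _ n]\<close>)
  also have "\<dots> = (\<Sum>i<n. \<Sum>j<n. cnj (?Y $$ (j, i)) * (?W $$ (j, i) * l i))"
    by (intro sum.cong refl)
       (use carrier_matD[OF Y] carrier_matD[OF W] in \<open>simp add: mat_diag_mult_right[OF W] del: index_mult_mat\<close>)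
  finally show ?thesis .
qed

lemma mtrace_mult_eigen:
  assumes A: "diagonalizes n A U l" and V: "unitary_mat n V"
  shows "mtrace (A * (V * mat_diag n (\<lambda>j. complex_of_real (g j)) * V\<^sup>\<dagger>))
    = complex_of_real (\<Sum>i<n. \<Sum>j<n. l i * g j * (cmod ((V\<^sup>\<dagger> * U) $$ (j, i)))\<^sup>2)"
proof -
  let ?L = "mat_diag n (\<lambda>i. complex_of_real (l i))" and ?G = "mat_diag n (\<lambda>j. complex_of_real (g j))"
  note U = diagonalizes_carrier[OF A]
  have c: "V \<in> carrier_mat n n" "V\<^sup>\<dagger> \<in> carrier_mat n n" using V by (auto simp: unitary_mat_def)
  note s = assoc_square[of _ n] mult_square[of _ n] adjoint_mult[of _ n n _ n]
  let ?W = "V\<^sup>\<dagger> * U"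
  have W: "?W \<in> carrier_mat n n" using U c by (auto simp: s)
  have AU: "A = U * ?L * U\<^sup>\<dagger>" using A by (simp add: diagonalizes_def)
  have "mtrace (A * (V * ?G * V\<^sup>\<dagger>)) = mtrace ((V * ?G * V\<^sup>\<dagger>) * A)"
    by (rule mtrace_comm[of _ n n]) (use U c in \<open>auto simp: s\<close>)
  also have "(V * ?G * V\<^sup>\<dagger>) * A = U * (?W\<^sup>\<dagger> * ?G * ?W * ?L) * U\<^sup>\<dagger>"
    unfolding AU using U c by (simp add: s unitary_cancel[OF U(4)])
  also have "mtrace \<dots> = mtrace (?W\<^sup>\<dagger> * ?G * ?W * ?L)"
    by (rule mtrace_unitary_conj[OF U(4)]) (use W in \<open>auto simp: mult_square[of _ n]\<close>)
  also have "\<dots> = complex_of_real (\<Sum>i<n. \<Sum>j<n. l i * g j * (cmod (?W $$ (j, i)))\<^sup>2)"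
    by (rule mtrace_sandwich[OF W])
  finally show ?thesis .
qed

text \<open>For fixed \<open>i\<close> the squared overlaps form a probability distribution in
  \<open>j\<close>. Summing over \<open>j\<close> therefore recovers quantities of the first
  operator alone, such as its trace.\<close>

lemma unitary_column_norm:
  assumes W: "unitary_mat n W" and i: "i < n"
  shows "(\<Sum>j<n. (cmod (W $$ (j, i)))\<^sup>2) = 1"
proof -
  have c: "W \<in> carrier_mat n n" "W\<^sup>\<dagger> \<in> carrier_mat n n" using W by (auto simp: unitary_mat_def)
  have "complex_of_real (\<Sum>j<n. (cmod (W $$ (j, i)))\<^sup>2) = (\<Sum>j<n. W\<^sup>\<dagger> $$ (i, j) * W $$ (j, i))"
    unfolding of_real_sum
    by (intro sum.cong refl) (use c i in \<open>simp add: complex_norm_square[unfolded of_real_power] mult.commute\<close>)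
  also have "\<dots> = (W\<^sup>\<dagger> * W) $$ (i, i)" by (rule mult_index[symmetric, OF c(2,1) i i])
  also have "\<dots> = 1" using W i by (simp add: unitary_mat_def)
  finally show ?thesis using of_real_eq_1_iff by blast
qed

lemma mtrace_eigen:
  assumes "diagonalizes n A U l"
  shows "mtrace A = complex_of_real (\<Sum>i<n. l i)"
  using mtrace_unitary_conj[of n U "mat_diag n (\<lambda>i. complex_of_real (l i))"] assms
  by (simp add: diagonalizes_def)

subsection \<open>Operators bounded from below\<close>

text \<open>Stating the bound with the trace pairing makes it pass to partial traces by duality.\<close>

definition bounded_below :: "nat \<Rightarrow> real \<Rightarrow> complex mat \<Rightarrow> bool" where
  "bounded_below n c A \<longleftrightarrow> hermitian_mat n A \<and>
     (\<forall>X\<in>carrier_mat n n. c * Re (mtrace (X * X\<^sup>\<dagger>)) \<le> Re (mtrace (X * X\<^sup>\<dagger> * A)))"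

lemma bounded_below_carrier: "bounded_below n c A \<Longrightarrow> A \<in> carrier_mat n n"
  by (simp add: bounded_below_def hermitian_mat_def)

lemma bounded_below_hermitian: "bounded_below n c A \<Longrightarrow> hermitian_mat n A"
  by (simp add: bounded_below_def)

lemma diagonalizes_one: "unitary_mat n U \<Longrightarrow> diagonalizes n (1\<^sub>m n) U (\<lambda>_. 1)"
  by (simp add: diagonalizes_def unitary_mat_def right_mult_one_mat[of _ n n])

lemma mtrace_square:
  assumes V: "unitary_mat n V" and U: "unitary_mat n U" and X: "X \<in> carrier_mat n n"
  shows "mtrace (X * X\<^sup>\<dagger>) = complex_of_real (\<Sum>i<n. \<Sum>j<n. (cmod ((V\<^sup>\<dagger> * X * U) $$ (j, i)))\<^sup>2)"
proof -
  have "X * X\<^sup>\<dagger> * 1\<^sub>m n = X * X\<^sup>\<dagger>" by (rule right_mult_one_mat) (use X in auto)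
  then show ?thesis using mtrace_form[OF diagonalizes_one[OF V] U X] by simp
qed

lemma bounded_below_eigenvalue:
  assumes b: "bounded_below n c A" and d: "diagonalizes n A U l" and k: "k < n"
  shows "c \<le> l k"
proof -
  note U = diagonalizes_carrier[OF d]
  \<comment> \<open>\<open>E\<close> is the projection onto the k-th eigenvector, written in the
    eigenbasis; testing the bound on it isolates \<open>l k\<close>.\<close>
  define E :: "complex mat" where "E = mat n n (\<lambda>(i, j). if i = k \<and> j = k then 1 else 0)"
  have E: "E \<in> carrier_mat n n" by (simp add: E_def)
  define X where "X = U * E * U\<^sup>\<dagger>"
  have X: "X \<in> carrier_mat n n" using U E by (simp add: X_def mult_square[of _ n])
  have Y: "U\<^sup>\<dagger> * X * U = E"
    using U E by (simp add: X_def assoc_square[of _ n] mult_square[of _ n] unitary_cancel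
       right_mult_one_mat[of _ n n] unitary_mat_def)
  have *: "(\<Sum>i<n. \<Sum>j<n. f j * (cmod (E $$ (j, i)))\<^sup>2) = f k" for f :: "nat \<Rightarrow> real"
  proof -
    have "(\<Sum>i<n. \<Sum>j<n. f j * (cmod (E $$ (j, i)))\<^sup>2) = (\<Sum>i<n. \<Sum>j<n. if j = k then if i = k then f j else 0 else 0)"
      by (intro sum.cong refl) (auto simp: E_def)
    then show ?thesis using k by simp
  qed
  have "c * Re (mtrace (X * X\<^sup>\<dagger>)) \<le> Re (mtrace (X * X\<^sup>\<dagger> * A))"
    using b X by (simp add: bounded_below_def)
  then show ?thesis
    using *[of "\<lambda>_. 1"] *[of l]
    by (simp add: mtrace_square[OF U(4) U(4) X] mtrace_form[OF d U(4) X] Y)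
qed

lemma bounded_belowI:
  assumes d: "diagonalizes n A U l" and l: "\<And>i. i < n \<Longrightarrow> c \<le> l i"
  shows "bounded_below n c A"
  unfolding bounded_below_def
proof (intro conjI ballI)
  fix X :: "complex mat" assume X: "X \<in> carrier_mat n n"
  note U = diagonalizes_carrier[OF d]
  show "c * Re (mtrace (X * X\<^sup>\<dagger>)) \<le> Re (mtrace (X * X\<^sup>\<dagger> * A))"
    unfolding mtrace_square[OF U(4) U(4) X] mtrace_form[OF d U(4) X] Re_complex_of_real sum_distrib_left
    by (intro sum_mono mult_right_mono) (use l in auto)
qed (rule diagonalizes_hermitian[OF d])

text \<open>Test the bound on X tensored with the identity, whose squared Hilbert-Schmidt norm is
  \<open>b\<close> times that of X; this is the factor in the new bound.\<close>

lemma bounded_below_ptrace2: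
  assumes "bounded_below (a * b) c A"
  shows "bounded_below a (real b * c) (ptrace2 a b A)"
  unfolding bounded_below_def
proof (intro conjI ballI)
  have A: "A \<in> carrier_mat (a * b) (a * b)" "A\<^sup>\<dagger> = A"
    using assms by (auto simp: bounded_below_def hermitian_mat_def)
  then show "hermitian_mat a (ptrace2 a b A)" by (simp add: hermitian_mat_def ptrace2_adjoint)
  fix X :: "complex mat" assume X: "X \<in> carrier_mat a a"
  let ?K = "kron a b X (1\<^sub>m b)"
  have K: "?K * ?K\<^sup>\<dagger> = kron a b (X * X\<^sup>\<dagger>) (1\<^sub>m b)"
    using X by (simp add: kron_adjoint kron_mult)
  have "c * Re (mtrace (?K * ?K\<^sup>\<dagger>)) \<le> Re (mtrace (?K * ?K\<^sup>\<dagger> * A))"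
    using assms by (simp add: bounded_below_def)
  then show "real b * c * Re (mtrace (X * X\<^sup>\<dagger>)) \<le> Re (mtrace (X * X\<^sup>\<dagger> * ptrace2 a b A))"
    unfolding K using X A
    by (simp add: mtrace_ptrace2 mult_square[of _ a] mtrace_kron algebra_simps)
qed

lemma bounded_below_ptrace_mid:
  assumes "bounded_below (a * m * b) c A"
  shows "bounded_below (a * b) (real m * c) (ptrace_mid a m b A)"
  unfolding bounded_below_def
proof (intro conjI ballI)
  have A: "A \<in> carrier_mat (a * m * b) (a * m * b)" "A\<^sup>\<dagger> = A"
    using assms by (auto simp: bounded_below_def hermitian_mat_def)
  then show "hermitian_mat (a * b) (ptrace_mid a m b A)" by (simp add: hermitian_mat_def ptrace_mid_adjoint)
  fix X :: "complex mat" assume X: "X \<in> carrier_mat (a * b) (a * b)"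
  let ?K = "lift_SR a m b X"
  have K: "?K * ?K\<^sup>\<dagger> = lift_SR a m b (X * X\<^sup>\<dagger>)"
    using X by (simp add: lift_SR_adjoint lift_SR_mult)
  have XX: "X * X\<^sup>\<dagger> \<in> carrier_mat (a * b) (a * b)" using X by (simp add: mult_square[of _ "a * b"])
  \<comment> \<open>Tracing the identity over the memory gives the constant: lifting an operator
    multiplies its trace by \<open>m\<close>.\<close>
  have "ptrace_mid a m b (1\<^sub>m (a * m * b)) = of_nat m \<cdot>\<^sub>m 1\<^sub>m (a * b)"
    unfolding kron_one[of "a * m" b, symmetric] kron_one[of a b, symmetric] ptrace_mid_kron ptrace2_one
    by (rule eq_mat_product[of _ a b]) (auto simp: mult_add_less)
  then have "mtrace (lift_SR a m b (X * X\<^sup>\<dagger>)) = of_nat m * mtrace (X * X\<^sup>\<dagger>)"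
    using mtrace_ptrace_mid[OF XX, of "1\<^sub>m (a * m * b)" m] XX
    by (simp add: right_mult_one_mat[OF lift_SR_carrier] mult_smult_distrib[of _ "a*b" "a*b" _ "a*b"]
        mtrace_smult[of _ "a * b"] right_mult_one_mat[of _ "a * b" "a * b"])
  moreover have "c * Re (mtrace (?K * ?K\<^sup>\<dagger>)) \<le> Re (mtrace (?K * ?K\<^sup>\<dagger> * A))"
    using assms by (simp add: bounded_below_def)
  ultimately show "real m * c * Re (mtrace (X * X\<^sup>\<dagger>)) \<le> Re (mtrace (X * X\<^sup>\<dagger> * ptrace_mid a m b A))"
    unfolding K using XX A by (simp add: mtrace_ptrace_mid algebra_simps)
qed

subsection \<open>Monotonicity of the relative entropy\<close>

text \<open>Since \<open>ln\<close> is total, a kernel of \<open>\<sigma>\<close> would produce a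
  finite value in place of infinity; the inequalities below assume \<open>\<sigma>\<close> positive
  definite.\<close>

definition rel_entropy :: "nat \<Rightarrow> complex mat \<Rightarrow> complex mat \<Rightarrow> real" where
  "rel_entropy n \<rho> \<sigma> = Re (mtrace (\<rho> * mat_ln n \<rho>)) - Re (mtrace (\<rho> * mat_ln n \<sigma>))"

text \<open>The overlaps with a fixed \<open>i\<close> sum to 1, which spreads the entropy term of
  \<open>\<rho>\<close> over all pairs of eigenvectors. Both logarithms then carry the same weights,
  as in a classical relative entropy on pairs.\<close>

lemma rel_entropy_eq:
  assumes \<rho>: "diagonalizes n \<rho> U l" and \<sigma>: "diagonalizes n \<sigma> V m"
  shows "rel_entropy n \<rho> \<sigma> = (\<Sum>i<n. \<Sum>j<n. (cmod ((V\<^sup>\<dagger> * U) $$ (j, i)))\<^sup>2 * l i * (ln (l i) - ln (m j)))"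
proof -
  note U = diagonalizes_carrier[OF \<rho>] and V = diagonalizes_carrier[OF \<sigma>]
  have W: "unitary_mat n (V\<^sup>\<dagger> * U)" by (rule unitary_mult[OF unitary_adjoint[OF V(4)] U(4)])
  have "Re (mtrace (\<rho> * mat_ln n \<rho>)) = (\<Sum>i<n. l i * ln (l i) * (\<Sum>j<n. (cmod ((V\<^sup>\<dagger> * U) $$ (j, i)))\<^sup>2))"
    using vn_entropy_eq[OF \<rho>] unitary_column_norm[OF W] by (simp add: vn_entropy_def)
  moreover have "Re (mtrace (\<rho> * mat_ln n \<sigma>)) = (\<Sum>i<n. \<Sum>j<n. l i * ln (m j) * (cmod ((V\<^sup>\<dagger> * U) $$ (j, i)))\<^sup>2)"
    unfolding mat_ln_eq[OF \<sigma>] mtrace_mult_eigen[OF \<rho> V(4)] by simp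
  ultimately show ?thesis
    by (simp add: rel_entropy_def sum_distrib_left sum_subtractf[symmetric] algebra_simps)
qed

text \<open>For positive definite \<open>\<sigma>\<close> the supremum of this functional over \<open>X\<close> is the pairing of \<open>\<rho>\<close> with
  the inverse of (left multiplication by \<open>\<sigma>\<close>) + \<open>t\<close> (right multiplication by \<open>\<rho>\<close>) applied to \<open>\<rho>\<close>;
  in eigenbases the supremum is found entry by entry by completing the square.\<close>

definition quadratic_functional :: "real \<Rightarrow> complex mat \<Rightarrow> complex mat \<Rightarrow> complex mat \<Rightarrow> real" where
  "quadratic_functional t \<rho> \<sigma> X =
     2 * Re (mtrace (X\<^sup>\<dagger> * \<rho>)) - Re (mtrace (X * X\<^sup>\<dagger> * \<sigma>)) - t * Re (mtrace (X\<^sup>\<dagger> * X * \<rho>))"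

lemma quadratic_functional_eq:
  assumes \<rho>: "diagonalizes n \<rho> U l" and \<sigma>: "diagonalizes n \<sigma> V m" and X: "X \<in> carrier_mat n n"
  shows "quadratic_functional t \<rho> \<sigma> X = (\<Sum>i<n. \<Sum>j<n.
    2 * l i * Re (cnj ((V\<^sup>\<dagger> * X * U) $$ (j, i)) * (V\<^sup>\<dagger> * U) $$ (j, i)) - (m j + t * l i) * (cmod ((V\<^sup>\<dagger> * X * U) $$ (j, i)))\<^sup>2)"
proof -
  note U = diagonalizes_carrier[OF \<rho>] and V = diagonalizes_carrier[OF \<sigma>]
  have Re: "Re (z * (w * complex_of_real r)) = r * Re (z * w)" for z w r
    by (simp add: algebra_simps)
  show ?thesis
    unfolding quadratic_functional_def mtrace_form[OF \<sigma> U(4) X] mtrace_form'[OF \<rho> V(4) X]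
      mtrace_pairing[OF \<rho> V(4) X] Re_complex_of_real Re_sum Re
    by (simp only: sum_distrib_left sum_subtractf[symmetric], intro sum.cong refl)
       (simp add: algebra_simps del: index_mult_mat times_complex.sel)
qed

text \<open>Bounding the real part by the modulus leaves 0 <= (d |y| - l |w|)^2, divided by
  d.\<close>

lemma complete_square_bound:
  fixes l d :: real and y w :: complex
  assumes "0 < d" "0 \<le> l"
  shows "2 * l * Re (cnj y * w) - d * (cmod y)\<^sup>2 \<le> (cmod w)\<^sup>2 * l\<^sup>2 / d"
proof -
  have "Re (cnj y * w) \<le> cmod y * cmod w"
    using complex_Re_le_cmod[of "cnj y * w"] by (simp add: norm_mult)
  then have "2 * l * Re (cnj y * w) \<le> 2 * l * (cmod y * cmod w)"
    using assms by (intro mult_left_mono) auto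
  moreover have "2 * l * (cmod y * cmod w) * d \<le> d * (cmod y)\<^sup>2 * d + (cmod w)\<^sup>2 * l\<^sup>2"
    using zero_le_power2[of "d * cmod y - l * cmod w"] by (simp add: power2_eq_square algebra_simps)
  then have "2 * l * (cmod y * cmod w) \<le> (d * (cmod y)\<^sup>2 * d + (cmod w)\<^sup>2 * l\<^sup>2) / d"
    using assms by (simp only: pos_le_divide_eq)
  then have "2 * l * (cmod y * cmod w) - d * (cmod y)\<^sup>2 \<le> (cmod w)\<^sup>2 * l\<^sup>2 / d"
    using assms by (simp add: add_divide_distrib)
  ultimately show ?thesis by linarith
qed

lemma quadratic_functional_le:
  assumes \<rho>: "diagonalizes n \<rho> U l" and \<sigma>: "diagonalizes n \<sigma> V m" and X: "X \<in> carrier_mat n n"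
    and l: "\<And>i. i < n \<Longrightarrow> 0 \<le> l i" and m: "\<And>j. j < n \<Longrightarrow> 0 < m j" and t: "0 \<le> t"
  shows "quadratic_functional t \<rho> \<sigma> X \<le> (\<Sum>i<n. \<Sum>j<n. (cmod ((V\<^sup>\<dagger> * U) $$ (j, i)))\<^sup>2 * (l i)\<^sup>2 / (m j + t * l i))"
  unfolding quadratic_functional_eq[OF \<rho> \<sigma> X]
  by (intro sum_mono complete_square_bound) (use l m t in \<open>auto intro: add_pos_nonneg\<close>)

lemma quadratic_functional_attained:
  assumes \<rho>: "diagonalizes n \<rho> U l" and \<sigma>: "diagonalizes n \<sigma> V m"
    and l: "\<And>i. i < n \<Longrightarrow> 0 \<le> l i" and m: "\<And>j. j < n \<Longrightarrow> 0 < m j" and t: "0 \<le> t"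
  obtains X where "X \<in> carrier_mat n n"
    "quadratic_functional t \<rho> \<sigma> X = (\<Sum>i<n. \<Sum>j<n. (cmod ((V\<^sup>\<dagger> * U) $$ (j, i)))\<^sup>2 * (l i)\<^sup>2 / (m j + t * l i))"
proof -
  note U = diagonalizes_carrier[OF \<rho>] and V = diagonalizes_carrier[OF \<sigma>]
  define W where "W = V\<^sup>\<dagger> * U"
  \<comment> \<open>The equality case of \<open>complete_square_bound\<close> in each entry, y = w l
    / d with d = m + t l; \<open>X\<close> is this matrix carried back to the original
    basis.\<close>
  define Y where "Y = mat n n (\<lambda>(j, i). W $$ (j, i) * complex_of_real (l i / (m j + t * l i)))"
  have Y: "Y \<in> carrier_mat n n" by (simp add: Y_def)
  define X where "X = V * Y * U\<^sup>\<dagger>"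
  have X: "X \<in> carrier_mat n n" using U V Y by (simp add: X_def mult_square[of _ n])
  have VXU: "V\<^sup>\<dagger> * X * U = Y"
    using U V Y by (simp add: X_def assoc_square[of _ n] mult_square[of _ n] unitary_cancel
       right_mult_one_mat[of _ n n] unitary_mat_def)
  have "quadratic_functional t \<rho> \<sigma> X = (\<Sum>i<n. \<Sum>j<n. (cmod (W $$ (j, i)))\<^sup>2 * (l i)\<^sup>2 / (m j + t * l i))"
    unfolding quadratic_functional_eq[OF \<rho> \<sigma> X] VXU W_def[symmetric]
  proof (intro sum.cong refl)
    fix i j assume "i \<in> {..<n}" "j \<in> {..<n}"
    then have ij: "i < n" "j < n" by auto
    define d where "d = m j + t * l i"
    have d: "d > 0" unfolding d_def using l[OF ij(1)] m[OF ij(2)] t by (intro add_pos_nonneg) auto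
    have Yji: "Y $$ (j, i) = W $$ (j, i) * complex_of_real (l i / d)" using ij by (simp add: Y_def d_def)
    have "Re (cnj (W $$ (j, i)) * W $$ (j, i)) = (cmod (W $$ (j, i)))\<^sup>2"
      by (metis Re_complex_of_real complex_norm_square mult.commute)
    then have 1: "Re (cnj (Y $$ (j, i)) * W $$ (j, i)) = (cmod (W $$ (j, i)))\<^sup>2 * (l i / d)"
      unfolding Yji by (simp add: algebra_simps add_divide_distrib[symmetric])
    have 2: "(cmod (Y $$ (j, i)))\<^sup>2 = (cmod (W $$ (j, i)))\<^sup>2 * (l i / d)\<^sup>2"
      unfolding Yji by (simp add: norm_mult power_mult_distrib norm_divide power_divide del: of_real_divide)
    show "2 * l i * Re (cnj (Y $$ (j, i)) * W $$ (j, i)) - (m j + t * l i) * (cmod (Y $$ (j, i)))\<^sup>2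
        = (cmod (W $$ (j, i)))\<^sup>2 * (l i)\<^sup>2 / (m j + t * l i)"
      unfolding d_def[symmetric] 1 2 using d by (simp add: power2_eq_square field_simps)
  qed
  then show ?thesis using that X unfolding W_def by blast
qed

text \<open>Each term pairs \<open>\<rho>\<close> or \<open>\<sigma>\<close> with an operator formed
  from \<open>X\<close> by products and adjoints. Tensoring with the identity respects both, so
  duality applies term by term.\<close>

lemma quadratic_functional_ptrace2:
  assumes "X \<in> carrier_mat a a" "\<rho> \<in> carrier_mat (a * b) (a * b)" "\<sigma> \<in> carrier_mat (a * b) (a * b)"
  shows "quadratic_functional t (ptrace2 a b \<rho>) (ptrace2 a b \<sigma>) X
    = quadratic_functional t \<rho> \<sigma> (kron a b X (1\<^sub>m b))"
  using assms
  by (simp add: quadratic_functional_def kron_adjoint kron_mult mtrace_ptrace2 mult_square[of _ a])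

text \<open>Subtracting \<open>ln (m i)\<close> normalises the antiderivative to vanish at t = 0, so
  a comparison of two such sums starts from equality.\<close>

lemma log_sum_derivative:
  fixes c l m :: "'i \<Rightarrow> real"
  assumes l: "\<And>i. i \<in> I \<Longrightarrow> 0 \<le> l i" and m: "\<And>i. i \<in> I \<Longrightarrow> 0 < m i" and t: "0 \<le> t"
  shows "((\<lambda>t. \<Sum>i\<in>I. c i * l i * (ln (m i + t * l i) - ln (m i))) has_real_derivative
    (\<Sum>i\<in>I. c i * (l i)\<^sup>2 / (m i + t * l i))) (at t)"
proof (rule DERIV_sum)
  fix i assume i: "i \<in> I"
  have "0 < m i + t * l i" using l[OF i] m[OF i] t by (intro add_pos_nonneg) auto
  then show "((\<lambda>t. c i * l i * (ln (m i + t * l i) - ln (m i))) has_real_derivative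
      c i * (l i)\<^sup>2 / (m i + t * l i)) (at t)"
    by (auto intro!: derivative_eq_intros simp: power2_eq_square)
qed

text \<open>For positive t, ln (m + t l) - ln t = ln (m / t + l), which tends to ln l when l is
  positive; when l = 0 the coefficient removes the term.\<close>

lemma log_sum_limit:
  fixes c l m :: "'i \<Rightarrow> real"
  assumes l: "\<And>i. i \<in> I \<Longrightarrow> 0 \<le> l i" and m: "\<And>i. i \<in> I \<Longrightarrow> 0 < m i"
  shows "((\<lambda>t. (\<Sum>i\<in>I. c i * l i * (ln (m i + t * l i) - ln (m i))) - (\<Sum>i\<in>I. c i * l i) * ln t)
    \<longlongrightarrow> (\<Sum>i\<in>I. c i * l i * (ln (l i) - ln (m i)))) at_top"
proof -
  have "((\<lambda>t. \<Sum>i\<in>I. c i * l i * (ln (m i / t + l i) - ln (m i))) \<longlongrightarrow> (\<Sum>i\<in>I. c i * l i * (ln (l i) - ln (m i)))) at_top"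
  proof (rule tendsto_sum)
    fix i assume i: "i \<in> I"
    show "((\<lambda>t. c i * l i * (ln (m i / t + l i) - ln (m i))) \<longlongrightarrow> c i * l i * (ln (l i) - ln (m i))) at_top"
    proof (cases "l i = 0")
      case False
      have "((\<lambda>t. m i / t + l i) \<longlongrightarrow> 0 + l i) at_top"
        by (intro tendsto_intros tendsto_divide_0[OF tendsto_const] filterlim_at_top_imp_at_infinity filterlim_ident)
      then have "((\<lambda>t. m i / t + l i) \<longlongrightarrow> l i) at_top" by simp
      then show ?thesis using False by (intro tendsto_intros)
    qed simp
  qed
  moreover have "\<forall>\<^sub>F t in at_top. (\<Sum>i\<in>I. c i * l i * (ln (m i / t + l i) - ln (m i)))
      = (\<Sum>i\<in>I. c i * l i * (ln (m i + t * l i) - ln (m i))) - (\<Sum>i\<in>I. c i * l i) * ln t"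
    using eventually_gt_at_top[of 0]
  proof eventually_elim
    case (elim t)
    have *: "ln (m i / t + l i) = ln (m i + t * l i) - ln t" if "i \<in> I" for i
    proof -
      have "m i / t + l i = (m i + t * l i) / t" using elim by (simp add: field_simps)
      moreover have "0 < m i + t * l i" using l[OF that] m[OF that] elim by (intro add_pos_nonneg) auto
      ultimately show ?thesis using elim by (simp add: ln_div)
    qed
    show ?case
      by (simp only: sum_distrib_right sum_subtractf[symmetric], intro sum.cong refl, simp only: *)
         (simp add: algebra_simps)
  qed
  ultimately show ?thesis by (rule Lim_transform_eventually)
qed

text \<open>The rational sums in the hypothesis are the \<open>t\<close>-derivatives of logarithmic sums; integrating from
  0 to \<open>T\<close> and letting \<open>T\<close> tend to infinity, the equal masses cancel the divergent \<open>ln T\<close>.\<close>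

lemma log_sum_comparison:
  fixes c l m :: "'i \<Rightarrow> real" and c' l' m' :: "'j \<Rightarrow> real"
  assumes l: "\<And>i. i \<in> I \<Longrightarrow> 0 \<le> l i" and m: "\<And>i. i \<in> I \<Longrightarrow> 0 < m i"
    and l': "\<And>i. i \<in> J \<Longrightarrow> 0 \<le> l' i" and m': "\<And>i. i \<in> J \<Longrightarrow> 0 < m' i"
    and mass: "(\<Sum>i\<in>I. c i * l i) = (\<Sum>i\<in>J. c' i * l' i)"
    and le: "\<And>t. 0 \<le> t \<Longrightarrow> (\<Sum>i\<in>I. c i * (l i)\<^sup>2 / (m i + t * l i)) \<le> (\<Sum>i\<in>J. c' i * (l' i)\<^sup>2 / (m' i + t * l' i))"
  shows "(\<Sum>i\<in>I. c i * l i * (ln (l i) - ln (m i))) \<le> (\<Sum>i\<in>J. c' i * l' i * (ln (l' i) - ln (m' i)))"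
proof -
  define G where "G t = (\<Sum>i\<in>I. c i * l i * (ln (m i + t * l i) - ln (m i)))" for t
  define H where "H t = (\<Sum>i\<in>J. c' i * l' i * (ln (m' i + t * l' i) - ln (m' i)))" for t
  have GH: "G T \<le> H T" if "0 \<le> T" for T
  proof -
    have "H 0 - G 0 \<le> H T - G T"
    proof (rule DERIV_nonneg_imp_nondecreasing[OF that])
      fix t :: real assume t: "0 \<le> t" "t \<le> T"
      have "((\<lambda>t. H t - G t) has_real_derivative (\<Sum>i\<in>J. c' i * (l' i)\<^sup>2 / (m' i + t * l' i))
          - (\<Sum>i\<in>I. c i * (l i)\<^sup>2 / (m i + t * l i))) (at t)"
        unfolding G_def H_def
        by (intro DERIV_diff log_sum_derivative l m l' m' t)
      then show "\<exists>y. ((\<lambda>t. H t - G t) has_real_derivative y) (at t) \<and> 0 \<le> y"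
        using le[OF t(1)] by (intro exI conjI) auto
    qed
    then show ?thesis by (simp add: G_def H_def)
  qed
  have "\<forall>\<^sub>F T in at_top. G T - (\<Sum>i\<in>I. c i * l i) * ln T \<le> H T - (\<Sum>i\<in>J. c' i * l' i) * ln T"
    using eventually_ge_at_top[of 0] by eventually_elim (simp add: mass GH)
  then show ?thesis
    unfolding G_def H_def
    by (intro tendsto_le[OF _ log_sum_limit[OF l' m', of J "\<lambda>i. i" "\<lambda>i. i" c'] log_sum_limit[OF l m, of I "\<lambda>i. i" "\<lambda>i. i" c]]) auto
qed

text \<open>The logarithmic sums run over pairs of eigenvectors, weighted by squared overlaps. Their
  masses are the traces, which a partial trace preserves; \<open>c\<close> and \<open>b\<close>
  positive keep \<open>\<sigma>\<close> and its marginal positive definite.\<close>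

theorem rel_entropy_ptrace2_le:
  assumes \<rho>: "bounded_below (a * b) 0 \<rho>" and \<sigma>: "bounded_below (a * b) c \<sigma>" and c: "0 < c" and b: "0 < b"
  shows "rel_entropy a (ptrace2 a b \<rho>) (ptrace2 a b \<sigma>) \<le> rel_entropy (a * b) \<rho> \<sigma>"
proof -
  let ?n = "a * b"
  let ?\<rho> = "ptrace2 a b \<rho>" and ?\<sigma> = "ptrace2 a b \<sigma>"
  have \<rho>': "bounded_below a 0 ?\<rho>" using bounded_below_ptrace2[OF \<rho>] by simp
  have \<sigma>': "bounded_below a (real b * c) ?\<sigma>" by (rule bounded_below_ptrace2[OF \<sigma>])
  obtain U l where Ul: "diagonalizes ?n \<rho> U l" using spectral_theorem bounded_below_hermitian[OF \<rho>] by blast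
  obtain V m where Vm: "diagonalizes ?n \<sigma> V m" using spectral_theorem bounded_below_hermitian[OF \<sigma>] by blast
  obtain U' l' where Ul': "diagonalizes a ?\<rho> U' l'" using spectral_theorem bounded_below_hermitian[OF \<rho>'] by blast
  obtain V' m' where Vm': "diagonalizes a ?\<sigma> V' m'" using spectral_theorem bounded_below_hermitian[OF \<sigma>'] by blast
  have l: "0 \<le> l i" if "i < ?n" for i by (rule bounded_below_eigenvalue[OF \<rho> Ul that])
  have l': "0 \<le> l' i" if "i < a" for i by (rule bounded_below_eigenvalue[OF \<rho>' Ul' that])
  have m: "0 < m i" if "i < ?n" for i using bounded_below_eigenvalue[OF \<sigma> Vm that] c by simp
  have bc: "0 < real b * c" using b c by simp
  have m': "0 < m' i" if "i < a" for i
    using bounded_below_eigenvalue[OF \<sigma>' Vm' that] bc by linarith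
  \<comment> \<open>Stated for arbitrary diagonalizations because it serves both the full operators
    and their marginals.\<close>
  have mass: "(\<Sum>(i, j)\<in>{..<N} \<times> {..<N}. (cmod ((V\<^sup>\<dagger> * U) $$ (j, i)))\<^sup>2 * l i) = Re (mtrace \<rho>)"
    if Ul: "diagonalizes N \<rho> U l" and Vm: "diagonalizes N \<sigma> V m" for N \<rho> \<sigma> U V l m
  proof -
    have W: "unitary_mat N (V\<^sup>\<dagger> * U)"
      by (intro unitary_mult unitary_adjoint diagonalizes_carrier(4)[OF Ul] diagonalizes_carrier(4)[OF Vm])
    show ?thesis
      unfolding mtrace_eigen[OF Ul] sum.cartesian_product[symmetric] sum_distrib_right[symmetric]
      using unitary_column_norm[OF W] by simp
  qed
  have "(\<Sum>(i, j)\<in>{..<a} \<times> {..<a}. (cmod ((V'\<^sup>\<dagger> * U') $$ (j, i)))\<^sup>2 * l' i * (ln (l' i) - ln (m' j)))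
      \<le> (\<Sum>(i, j)\<in>{..<?n} \<times> {..<?n}. (cmod ((V\<^sup>\<dagger> * U) $$ (j, i)))\<^sup>2 * l i * (ln (l i) - ln (m j)))"
    unfolding case_prod_unfold
  proof (rule log_sum_comparison)
    show "(\<Sum>p\<in>{..<a} \<times> {..<a}. (cmod ((V'\<^sup>\<dagger> * U') $$ (snd p, fst p)))\<^sup>2 * l' (fst p))
      = (\<Sum>p\<in>{..<?n} \<times> {..<?n}. (cmod ((V\<^sup>\<dagger> * U) $$ (snd p, fst p)))\<^sup>2 * l (fst p))"
      using mass[OF Ul Vm] mass[OF Ul' Vm'] mtrace_ptrace2_one[OF bounded_below_carrier[OF \<rho>]]
      by (simp add: case_prod_unfold)
    fix t :: real assume t: "0 \<le> t"
    \<comment> \<open>The optimal operator for the marginals; tensored with the identity it is only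
      one competitor for the full operators.\<close>
    obtain X where X: "X \<in> carrier_mat a a" and eq: "quadratic_functional t ?\<rho> ?\<sigma> X
        = (\<Sum>i<a. \<Sum>j<a. (cmod ((V'\<^sup>\<dagger> * U') $$ (j, i)))\<^sup>2 * (l' i)\<^sup>2 / (m' j + t * l' i))"
      using quadratic_functional_attained[OF Ul' Vm' l' m' t] by blast
    have "quadratic_functional t \<rho> \<sigma> (kron a b X (1\<^sub>m b))
        \<le> (\<Sum>i<?n. \<Sum>j<?n. (cmod ((V\<^sup>\<dagger> * U) $$ (j, i)))\<^sup>2 * (l i)\<^sup>2 / (m j + t * l i))"
      by (rule quadratic_functional_le[OF Ul Vm kron_carrier l m t])
    then show "(\<Sum>p\<in>{..<a} \<times> {..<a}. (cmod ((V'\<^sup>\<dagger> * U') $$ (snd p, fst p)))\<^sup>2 * (l' (fst p))\<^sup>2 / (m' (snd p) + t * l' (fst p)))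
      \<le> (\<Sum>p\<in>{..<?n} \<times> {..<?n}. (cmod ((V\<^sup>\<dagger> * U) $$ (snd p, fst p)))\<^sup>2 * (l (fst p))\<^sup>2 / (m (snd p) + t * l (fst p)))"
      using eq quadratic_functional_ptrace2[OF X bounded_below_carrier[OF \<rho>] bounded_below_carrier[OF \<sigma>], of t]
      by (simp add: sum.cartesian_product case_prod_unfold)
  qed (use l m l' m' in auto)
  then show ?thesis
    unfolding rel_entropy_eq[OF Ul Vm] rel_entropy_eq[OF Ul' Vm'] by (simp add: sum.cartesian_product)
qed

subsection \<open>Tensor products of operators and their entropy\<close>

lemma diagonalizes_kron:
  assumes A: "diagonalizes a A U l" and B: "diagonalizes b B V m"
  shows "diagonalizes (a * b) (kron a b A B) (kron a b U V) (\<lambda>p. l (p div b) * m (p mod b))"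
proof -
  note U = diagonalizes_carrier[OF A] and V = diagonalizes_carrier[OF B]
  let ?L = "mat_diag a (\<lambda>i. complex_of_real (l i))" and ?M = "mat_diag b (\<lambda>i. complex_of_real (m i))"
  have "kron a b A B = kron a b (U * ?L * U\<^sup>\<dagger>) (V * ?M * V\<^sup>\<dagger>)"
    using A B by (simp add: diagonalizes_def)
  also have "\<dots> = kron a b U V * kron a b ?L ?M * (kron a b U V)\<^sup>\<dagger>"
    using U V by (simp add: kron_adjoint kron_mult mult_square[of _ a] mult_square[of _ b])
  finally show ?thesis
    using unitary_kron[OF U(4) V(4)] by (simp add: diagonalizes_def kron_diag)
qed

lemma diagonalizes_lift_SR:
  assumes A: "diagonalizes (a * b) A U l"
  shows "diagonalizes (a * m * b) (lift_SR a m b A) (lift_SR a m b U) (\<lambda>p. l (p div b div m * b + p mod b))"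
proof -
  note U = diagonalizes_carrier[OF A]
  let ?L = "mat_diag (a * b) (\<lambda>i. complex_of_real (l i))"
  have "lift_SR a m b A = lift_SR a m b (U * ?L * U\<^sup>\<dagger>)"
    using A by (simp add: diagonalizes_def)
  also have "\<dots> = lift_SR a m b U * lift_SR a m b ?L * (lift_SR a m b U)\<^sup>\<dagger>"
    using U by (simp add: lift_SR_adjoint lift_SR_mult mult_square[of _ "a * b"])
  finally show ?thesis
    using unitary_lift_SR[OF U(4)] by (simp add: diagonalizes_def lift_SR_diag)
qed

lemma diagonalizes_unitary_conj:
  assumes A: "diagonalizes n A U l" and V: "unitary_mat n V"
  shows "diagonalizes n (V * A * V\<^sup>\<dagger>) (V * U) l"
proof -
  note U = diagonalizes_carrier[OF A]
  have "V \<in> carrier_mat n n" "V\<^sup>\<dagger> \<in> carrier_mat n n" using V by (auto simp: unitary_mat_def)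
  then show ?thesis
    using A U unitary_mult[OF V U(4)]
    by (simp add: diagonalizes_def assoc_square[of _ n] mult_square[of _ n] adjoint_mult[of _ n n _ n])
qed

text \<open>Used with slope 1 to regularise an operator by a multiple of the identity, and with
  slope \<open>- \<beta>\<close> for the logarithm of a Gibbs state.\<close>

lemma diagonalizes_affine:
  assumes A: "diagonalizes n A U l"
  shows "U * mat_diag n (\<lambda>i. complex_of_real (r * l i + c)) * U\<^sup>\<dagger>
    = complex_of_real r \<cdot>\<^sub>m A + complex_of_real c \<cdot>\<^sub>m 1\<^sub>m n"
proof -
  let ?L = "mat_diag n (\<lambda>i. complex_of_real (l i))"
  note U = diagonalizes_carrier[OF A]
  have *: "mat_diag n (\<lambda>i. complex_of_real (r * l i + c)) = complex_of_real r \<cdot>\<^sub>m ?L + complex_of_real c \<cdot>\<^sub>m 1\<^sub>m n"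
    by (rule eq_matI) (auto simp: mat_diag_def)
  have "U * (complex_of_real r \<cdot>\<^sub>m ?L + complex_of_real c \<cdot>\<^sub>m 1\<^sub>m n)
      = complex_of_real r \<cdot>\<^sub>m (U * ?L) + complex_of_real c \<cdot>\<^sub>m U"
    using U by (simp add: mult_add_distrib_mat[of _ n n _ n] mult_smult_distrib[of _ n n _ n]
        right_mult_one_mat[of _ n n])
  also have "\<dots> * U\<^sup>\<dagger> = complex_of_real r \<cdot>\<^sub>m (U * ?L * U\<^sup>\<dagger>) + complex_of_real c \<cdot>\<^sub>m (U * U\<^sup>\<dagger>)"
    using U by (simp add: add_mult_distrib_mat[of _ n n _ _ n] mult_smult_assoc_mat[of _ n n _ n] mult_square[of _ n])
  finally show ?thesis
    using A unfolding * by (simp add: diagonalizes_def unitary_mat_def)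
qed

lemma diagonalizes_add:
  assumes A: "diagonalizes n A U l"
  shows "diagonalizes n (A + complex_of_real c \<cdot>\<^sub>m 1\<^sub>m n) U (\<lambda>i. l i + c)"
proof -
  have "complex_of_real 1 \<cdot>\<^sub>m A = A" by (rule eq_matI) auto
  then show ?thesis
    using diagonalizes_affine[OF A, of 1 c] A by (simp add: diagonalizes_def)
qed

lemma mat_ln_carrier:
  assumes "hermitian_mat n A"
  shows "mat_ln n A \<in> carrier_mat n n"
proof -
  obtain U l where d: "diagonalizes n A U l" using spectral_theorem[OF assms] .
  show ?thesis unfolding mat_ln_eq[OF d] using diagonalizes_carrier[OF d] by (simp add: mult_square[of _ n])
qed

text \<open>Tensoring with the identity only repeats eigenvalues. A normalised identity would add a
  multiple of the identity to the logarithm.\<close>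

lemma mat_ln_kron_one:
  assumes "hermitian_mat a A"
  shows "mat_ln (a * b) (kron a b A (1\<^sub>m b)) = kron a b (mat_ln a A) (1\<^sub>m b)"
proof -
  obtain U l where d: "diagonalizes a A U l" using spectral_theorem[OF assms] .
  note U = diagonalizes_carrier[OF d]
  have "kron a b (mat_ln a A) (1\<^sub>m b)
      = kron a b U (1\<^sub>m b) * kron a b (mat_diag a (\<lambda>i. complex_of_real (ln (l i)))) (mat_diag b (\<lambda>_. 1)) * (kron a b U (1\<^sub>m b))\<^sup>\<dagger>"
    unfolding mat_ln_eq[OF d] using U by (simp add: kron_adjoint kron_mult mult_square[of _ a])
  then show ?thesis
    unfolding kron_diag mat_ln_eq[OF diagonalizes_kron[OF d diagonalizes_one[OF unitary_one]]] by simp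
qed

lemma mat_ln_lift_SR:
  assumes "hermitian_mat (a * b) A"
  shows "mat_ln (a * m * b) (lift_SR a m b A) = lift_SR a m b (mat_ln (a * b) A)"
proof -
  obtain U l where d: "diagonalizes (a * b) A U l" using spectral_theorem[OF assms] .
  note U = diagonalizes_carrier[OF d]
  have "lift_SR a m b (mat_ln (a * b) A)
      = lift_SR a m b U * lift_SR a m b (mat_diag (a * b) (\<lambda>i. complex_of_real (ln (l i)))) * (lift_SR a m b U)\<^sup>\<dagger>"
    unfolding mat_ln_eq[OF d] using U by (simp add: lift_SR_adjoint lift_SR_mult mult_square[of _ "a * b"])
  then show ?thesis
    unfolding lift_SR_diag mat_ln_eq[OF diagonalizes_lift_SR[OF d]] by simp
qed

lemma vn_entropy_unitary_conj:
  assumes "hermitian_mat n A" and V: "unitary_mat n V"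
  shows "vn_entropy n (V * A * V\<^sup>\<dagger>) = vn_entropy n A"
proof -
  obtain U l where d: "diagonalizes n A U l" using spectral_theorem[OF assms(1)] .
  show ?thesis unfolding vn_entropy_eq[OF d] vn_entropy_eq[OF diagonalizes_unitary_conj[OF d V]] ..
qed

text \<open>The logarithm of a product splits where both eigenvalues are positive, and elsewhere all
  terms vanish; the unit traces absorb the remaining factor in each sum.\<close>

lemma vn_entropy_kron:
  assumes A: "bounded_below a 0 A" "mtrace A = 1" and B: "bounded_below b 0 B" "mtrace B = 1"
  shows "vn_entropy (a * b) (kron a b A B) = vn_entropy a A + vn_entropy b B"
proof -
  obtain U l where Ul: "diagonalizes a A U l" using spectral_theorem bounded_below_hermitian[OF A(1)] by blast
  obtain V m where Vm: "diagonalizes b B V m" using spectral_theorem bounded_below_hermitian[OF B(1)] by blast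
  have l: "0 \<le> l i" if "i < a" for i by (rule bounded_below_eigenvalue[OF A(1) Ul that])
  have m: "0 \<le> m i" if "i < b" for i by (rule bounded_below_eigenvalue[OF B(1) Vm that])
  have sums: "(\<Sum>i<a. l i) = 1" "(\<Sum>i<b. m i) = 1"
    using A(2) B(2) mtrace_eigen[OF Ul] mtrace_eigen[OF Vm] by (metis of_real_eq_1_iff)+
  have "(\<Sum>p<a * b. l (p div b) * m (p mod b) * ln (l (p div b) * m (p mod b)))
      = (\<Sum>i<a. \<Sum>k<b. l i * ln (l i) * m k + l i * (m k * ln (m k)))"
    unfolding sum_mult_index
  proof (intro sum.cong refl)
    fix i k assume "i \<in> {..<a}" "k \<in> {..<b}"
    then have ik: "i < a" "k < b" by auto
    then have dm: "(i * b + k) div b = i" "(i * b + k) mod b = k" by auto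
    show "l ((i * b + k) div b) * m ((i * b + k) mod b) * ln (l ((i * b + k) div b) * m ((i * b + k) mod b))
        = l i * ln (l i) * m k + l i * (m k * ln (m k))"
    proof (cases "l i = 0 \<or> m k = 0")
      case False
      then have "0 < l i" "0 < m k" using l[OF ik(1)] m[OF ik(2)] by auto
      then show ?thesis unfolding dm by (simp add: ln_mult algebra_simps)
    qed (use dm in auto)
  qed
  also have "\<dots> = (\<Sum>i<a. l i * ln (l i)) * (\<Sum>k<b. m k) + (\<Sum>i<a. l i) * (\<Sum>k<b. m k * ln (m k))"
    by (simp add: sum.distrib sum_product)
  finally show ?thesis
    unfolding vn_entropy_eq[OF diagonalizes_kron[OF Ul Vm]] vn_entropy_eq[OF Ul] vn_entropy_eq[OF Vm] sums by simp
qed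

lemma bounded_below_kron:
  assumes A: "bounded_below a 0 A" and B: "bounded_below b 0 B"
  shows "bounded_below (a * b) 0 (kron a b A B)"
proof -
  obtain U l where Ul: "diagonalizes a A U l" using spectral_theorem bounded_below_hermitian[OF A] by blast
  obtain V m where Vm: "diagonalizes b B V m" using spectral_theorem bounded_below_hermitian[OF B] by blast
  show ?thesis
    by (rule bounded_belowI[OF diagonalizes_kron[OF Ul Vm]])
       (auto intro!: mult_nonneg_nonneg bounded_below_eigenvalue[OF A Ul] bounded_below_eigenvalue[OF B Vm] div_mod_less_mult)
qed

lemma bounded_below_unitary_conj:
  assumes A: "bounded_below n c A" and V: "unitary_mat n V"
  shows "bounded_below n c (V * A * V\<^sup>\<dagger>)"
proof -
  obtain U l where Ul: "diagonalizes n A U l" using spectral_theorem bounded_below_hermitian[OF A] by blast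
  show ?thesis
    by (rule bounded_belowI[OF diagonalizes_unitary_conj[OF Ul V]]) (rule bounded_below_eigenvalue[OF A Ul])
qed

lemma bounded_below_lift_SR:
  assumes A: "bounded_below (a * b) c A"
  shows "bounded_below (a * m * b) c (lift_SR a m b A)"
proof -
  obtain U l where Ul: "diagonalizes (a * b) A U l" using spectral_theorem bounded_below_hermitian[OF A] by blast
  show ?thesis
  proof (rule bounded_belowI[OF diagonalizes_lift_SR[OF Ul]])
    fix p assume "p < a * m * b"
    note p = div_mod_less_mult(1,2)[OF this]
    have "p div b div m * b + p mod b < a * b"
      by (intro mult_add_less div_mod_less_mult(1)[OF p(1)] p(2))
    then show "c \<le> l (p div b div m * b + p mod b)" by (rule bounded_below_eigenvalue[OF A Ul])
  qed
qed

lemma bounded_below_add: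
  assumes A: "bounded_below n c A"
  shows "bounded_below n (c + r) (A + complex_of_real r \<cdot>\<^sub>m 1\<^sub>m n)"
proof -
  obtain U l where Ul: "diagonalizes n A U l" using spectral_theorem bounded_below_hermitian[OF A] by blast
  show ?thesis
    by (rule bounded_belowI[OF diagonalizes_add[OF Ul]]) (simp add: bounded_below_eigenvalue[OF A Ul])
qed

subsection \<open>Strong subadditivity\<close>

text \<open>Monotonicity under tracing out the last factor R, for \<open>\<rho>\<close> against its
  SR marginal lifted by the identity on M. Before the trace the relative entropy is S(SR) - S(SMR);
  afterwards the second operator is the S marginal times that identity up to no factor, and the
  relative entropy is S(S) - S(SM).\<close>

lemma strong_subadditivity_positive:
  assumes \<rho>: "bounded_below (a * m * b) c \<rho>" and c: "0 < c" and m: "0 < m" and b: "0 < b"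
  shows "vn_entropy (a * m * b) \<rho> + vn_entropy a (ptrace2 a b (ptrace_mid a m b \<rho>))
    \<le> vn_entropy (a * m) (ptrace2 (a * m) b \<rho>) + vn_entropy (a * b) (ptrace_mid a m b \<rho>)"
proof -
  let ?sr = "ptrace_mid a m b \<rho>" and ?sm = "ptrace2 (a * m) b \<rho>"
  let ?s = "ptrace2 a b ?sr"
  note \<rho>c = bounded_below_carrier[OF \<rho>]
  have sr: "bounded_below (a * b) (real m * c) ?sr" by (rule bounded_below_ptrace_mid[OF \<rho>])
  have \<sigma>: "bounded_below (a * m * b) (real m * c) (lift_SR a m b ?sr)" by (rule bounded_below_lift_SR[OF sr])
  have s: "hermitian_mat a ?s" by (rule bounded_below_hermitian[OF bounded_below_ptrace2[OF sr]])
  note srl = mat_ln_carrier[OF bounded_below_hermitian[OF sr]] and sl = mat_ln_carrier[OF s]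
  have \<rho>0: "bounded_below (a * m * b) 0 \<rho>"
  proof -
    obtain U l where Ul: "diagonalizes (a * m * b) \<rho> U l" using spectral_theorem bounded_below_hermitian[OF \<rho>] by blast
    show ?thesis
      by (rule bounded_belowI[OF Ul]) (use bounded_below_eigenvalue[OF \<rho> Ul] c in fastforce)
  qed
  have "mtrace (\<rho> * mat_ln (a * m * b) (lift_SR a m b ?sr)) = mtrace (lift_SR a m b (mat_ln (a * b) ?sr) * \<rho>)"
    unfolding mat_ln_lift_SR[OF bounded_below_hermitian[OF sr]] by (rule mtrace_comm[OF \<rho>c lift_SR_carrier])
  also have "\<dots> = mtrace (mat_ln (a * b) ?sr * ?sr)" by (rule mtrace_ptrace_mid[OF srl \<rho>c])
  also have "\<dots> = mtrace (?sr * mat_ln (a * b) ?sr)" by (rule mtrace_comm[OF srl ptrace_mid_carrier])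
  finally have 1: "rel_entropy (a * m * b) \<rho> (lift_SR a m b ?sr)
      = - vn_entropy (a * m * b) \<rho> + vn_entropy (a * b) ?sr"
    by (simp add: rel_entropy_def vn_entropy_def)
  have "mtrace (?sm * mat_ln (a * m) (kron a m ?s (1\<^sub>m m))) = mtrace (kron a m (mat_ln a ?s) (1\<^sub>m m) * ?sm)"
    unfolding mat_ln_kron_one[OF s] by (rule mtrace_comm[OF ptrace2_carrier kron_carrier])
  also have "\<dots> = mtrace (mat_ln a ?s * ptrace2 a m ?sm)" by (rule mtrace_ptrace2[OF sl ptrace2_carrier])
  also have "ptrace2 a m ?sm = ?s" by (rule ptrace2_ptrace2[OF \<rho>c])
  also have "mtrace (mat_ln a ?s * ?s) = mtrace (?s * mat_ln a ?s)" by (rule mtrace_comm[OF sl ptrace2_carrier])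
  finally have 2: "rel_entropy (a * m) ?sm (kron a m ?s (1\<^sub>m m)) = - vn_entropy (a * m) ?sm + vn_entropy a ?s"
    by (simp add: rel_entropy_def vn_entropy_def)
  have "rel_entropy (a * m) ?sm (ptrace2 (a * m) b (lift_SR a m b ?sr)) \<le> rel_entropy (a * m * b) \<rho> (lift_SR a m b ?sr)"
    by (rule rel_entropy_ptrace2_le[OF \<rho>0 \<sigma> _ b]) (use c m in simp)
  then show ?thesis unfolding ptrace2_lift_SR 1 2 by simp
qed

text \<open>Continuity of the logarithm settles positive \<open>x\<close>; at \<open>x = 0\<close>
  with \<open>k\<close> positive the limit is that of y ln y at 0.\<close>

lemma x_ln_x_tendsto:
  fixes x k :: real
  assumes "0 \<le> x" "0 \<le> k"
  shows "((\<lambda>e. (x + k * e) * ln (x + k * e)) \<longlongrightarrow> x * ln x) (at_right 0)"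
proof -
  consider "x > 0" | "x = 0" "k = 0" | "x = 0" "k > 0" using assms by fastforce
  then show ?thesis
  proof cases
    case 1
    have "((\<lambda>e. x + k * e) \<longlongrightarrow> x + k * 0) (at_right 0)" by (intro tendsto_intros)
    then have "((\<lambda>e. x + k * e) \<longlongrightarrow> x) (at_right 0)" by simp
    then show ?thesis using 1 by (intro tendsto_intros) auto
  next
    case 3
    have "((\<lambda>e. (k * e) * ln (k * e)) \<longlongrightarrow> 0) (at_right 0)" using 3 by real_asymp
    then show ?thesis using 3 by simp
  qed simp
qed

text \<open>The factor \<open>k\<close> is there for the marginals: tracing e times the identity
  over a factor of dimension d gives d e times the identity.\<close>

lemma vn_entropy_tendsto:
  assumes A: "bounded_below n 0 A" and k: "0 \<le> k"
  shows "((\<lambda>e. vn_entropy n (A + complex_of_real (k * e) \<cdot>\<^sub>m 1\<^sub>m n)) \<longlongrightarrow> vn_entropy n A) (at_right 0)"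
proof -
  obtain U l where Ul: "diagonalizes n A U l" using spectral_theorem bounded_below_hermitian[OF A] by blast
  show ?thesis
    unfolding vn_entropy_eq[OF diagonalizes_add[OF Ul]] vn_entropy_eq[OF Ul]
    by (intro tendsto_minus tendsto_sum x_ln_x_tendsto k bounded_below_eigenvalue[OF A Ul]) simp
qed

text \<open>Adding a small multiple of the identity reduces to the positive definite case, so no support
  conditions are needed.\<close>

theorem strong_subadditivity:
  assumes \<rho>: "bounded_below (a * m * b) 0 \<rho>" and m: "0 < m" and b: "0 < b"
  shows "vn_entropy (a * m * b) \<rho> + vn_entropy a (ptrace2 a b (ptrace_mid a m b \<rho>))
    \<le> vn_entropy (a * m) (ptrace2 (a * m) b \<rho>) + vn_entropy (a * b) (ptrace_mid a m b \<rho>)"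
proof -
  let ?sr = "ptrace_mid a m b \<rho>" and ?sm = "ptrace2 (a * m) b \<rho>"
  let ?s = "ptrace2 a b ?sr"
  note \<rho>c = bounded_below_carrier[OF \<rho>]
  have sr: "bounded_below (a * b) 0 ?sr" using bounded_below_ptrace_mid[OF \<rho>] by simp
  have sm: "bounded_below (a * m) 0 ?sm" using bounded_below_ptrace2[OF \<rho>] by simp
  have s: "bounded_below a 0 ?s" using bounded_below_ptrace2[OF sr] by simp
  \<comment> \<open>The factor in \<open>1 * e\<close> gives the perturbation the shape of
    \<open>vn_entropy_tendsto\<close> with \<open>k = 1\<close>.\<close>
  define R where "R e = \<rho> + complex_of_real (1 * e) \<cdot>\<^sub>m 1\<^sub>m (a * m * b)" for e
  have Rsr: "ptrace_mid a m b (R e) = ?sr + complex_of_real (real m * e) \<cdot>\<^sub>m 1\<^sub>m (a * b)" for e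
    using \<rho>c by (intro eq_mat_product[of _ a b])
      (auto simp: R_def mult_add_less prod_index_eq_iff sum.distrib)
  have Rsm: "ptrace2 (a * m) b (R e) = ?sm + complex_of_real (real b * e) \<cdot>\<^sub>m 1\<^sub>m (a * m)" for e
    using \<rho>c by (intro eq_matI)
      (auto simp: R_def ptrace2_def mult_add_less prod_index_eq_iff sum.distrib)
  have Rs: "ptrace2 a b (ptrace_mid a m b (R e)) = ?s + complex_of_real (real b * real m * e) \<cdot>\<^sub>m 1\<^sub>m a" for e
    unfolding Rsr by (intro eq_matI)
      (auto simp: ptrace2_def mult_add_less prod_index_eq_iff sum.distrib)
  have "\<forall>\<^sub>F e in at_right 0. vn_entropy (a * m * b) (R e) + vn_entropy a (ptrace2 a b (ptrace_mid a m b (R e)))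
    \<le> vn_entropy (a * m) (ptrace2 (a * m) b (R e)) + vn_entropy (a * b) (ptrace_mid a m b (R e))"
    using eventually_at_right_less[of 0]
  proof eventually_elim
    case (elim e)
    have "bounded_below (a * m * b) e (R e)" using bounded_below_add[OF \<rho>, of e] by (simp add: R_def)
    then show ?case using elim m b by (rule strong_subadditivity_positive)
  qed
  moreover have "((\<lambda>e. vn_entropy (a * m * b) (R e) + vn_entropy a (ptrace2 a b (ptrace_mid a m b (R e))))
      \<longlongrightarrow> vn_entropy (a * m * b) \<rho> + vn_entropy a ?s) (at_right 0)"
    unfolding Rs unfolding R_def by (intro tendsto_add vn_entropy_tendsto \<rho> s) auto
  moreover have "((\<lambda>e. vn_entropy (a * m) (ptrace2 (a * m) b (R e)) + vn_entropy (a * b) (ptrace_mid a m b (R e)))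
      \<longlongrightarrow> vn_entropy (a * m) ?sm + vn_entropy (a * b) ?sr) (at_right 0)"
    unfolding Rsm Rsr by (intro tendsto_add vn_entropy_tendsto sm sr) auto
  ultimately show ?thesis
    by (intro tendsto_le) (auto simp: trivial_limit_at_right_real)
qed

section \<open>Consequences obtained from one-dimensional factors\<close>

lemma one_dim_mat_eq:
  assumes "A \<in> carrier_mat 1 1" "mtrace A = 1"
  shows "A = 1\<^sub>m 1"
  by (rule eq_matI) (use assms in \<open>auto simp: mtrace_def\<close>)

text \<open>Strong subadditivity with a one-dimensional first factor: tracing out the middle becomes
  \<open>ptrace1\<close>, and the state of the first factor is the scalar 1, of entropy 0.\<close>

lemma subadditivity:
  assumes \<rho>: "bounded_below (a * b) 0 \<rho>" "mtrace \<rho> = 1" and pos: "0 < a" "0 < b"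
  shows "vn_entropy (a * b) \<rho> \<le> vn_entropy a (ptrace2 a b \<rho>) + vn_entropy b (ptrace1 a b \<rho>)"
proof -
  note \<rho>c = bounded_below_carrier[OF \<rho>(1)]
  have 1: "ptrace_mid 1 a b \<rho> = ptrace1 a b \<rho>"
    by (rule eq_matI) (auto simp: ptrace_mid_def ptrace1_def)
  have "mtrace (ptrace2 1 b (ptrace1 a b \<rho>)) = mtrace (ptrace1 a b \<rho>)"
    by (rule mtrace_ptrace2_one) simp
  also have "\<dots> = mtrace \<rho>"
    using mtrace_ptrace1[of "1\<^sub>m b" b \<rho> a] left_mult_one_mat[OF \<rho>c] left_mult_one_mat[OF ptrace1_carrier] \<rho>c
    by (simp add: kron_one)
  finally have "ptrace2 1 b (ptrace1 a b \<rho>) = 1\<^sub>m 1" using \<rho>(2) by (intro one_dim_mat_eq) auto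
  moreover have "vn_entropy 1 (1\<^sub>m 1) = 0"
    using vn_entropy_eq[OF diagonalizes_one[OF unitary_one[of 1]]] by simp
  ultimately show ?thesis using strong_subadditivity[of 1 a b \<rho>] \<rho> pos 1 by simp
qed

text \<open>Klein's inequality as monotonicity under the full trace: both states become the scalar
  1, where the relative entropy is 0.\<close>

lemma rel_entropy_nonneg:
  assumes \<rho>: "bounded_below n 0 \<rho>" "mtrace \<rho> = 1" and \<sigma>: "bounded_below n c \<sigma>" "mtrace \<sigma> = 1"
    and c: "0 < c" and n: "0 < n"
  shows "0 \<le> rel_entropy n \<rho> \<sigma>"
proof -
  have 1: "ptrace2 1 n A = 1\<^sub>m 1" if "A \<in> carrier_mat n n" "mtrace A = 1" for A
    using that mtrace_ptrace2_one[of A 1 n] by (intro one_dim_mat_eq) auto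
  have "rel_entropy 1 (ptrace2 1 n \<rho>) (ptrace2 1 n \<sigma>) \<le> rel_entropy n \<rho> \<sigma>"
    using rel_entropy_ptrace2_le[of 1 n \<rho> c \<sigma>] assms by simp
  then show ?thesis
    using 1 bounded_below_carrier[OF \<rho>(1)] bounded_below_carrier[OF \<sigma>(1)] \<rho> \<sigma> by (simp add: rel_entropy_def)
qed

subsection \<open>Gibbs states and the second law\<close>

text \<open>Positivity on vectors is tested on the columns of \<open>U\<close>: the eigenvalue
  \<open>l i\<close> is the expectation of \<open>\<rho>\<close> in the i-th column.\<close>

lemma density_op_bounded_below:
  assumes "density_op n \<rho>"
  shows "bounded_below n 0 \<rho>"
proof -
  have h: "hermitian_mat n \<rho>" using assms by (simp add: density_op_def)
  then have \<rho>: "\<rho> \<in> carrier_mat n n" by (simp add: hermitian_mat_def)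
  obtain U l where d: "diagonalizes n \<rho> U l" using spectral_theorem[OF h] .
  note U = diagonalizes_carrier[OF d]
  show ?thesis
  proof (rule bounded_belowI[OF d])
    fix i assume i: "i < n"
    have ci: "col U i \<in> carrier_vec n" using U i by auto
    have "U\<^sup>\<dagger> * \<rho> * U = mat_diag n (\<lambda>i. complex_of_real (l i))"
      using d U by (simp add: diagonalizes_def assoc_square[of _ n] mult_square[of _ n] unitary_cancel
        unitary_mat_def right_mult_one_mat[of _ n n])
    then have "complex_of_real (l i) = (U\<^sup>\<dagger> * (\<rho> * U)) $$ (i, i)"
      using i U by (simp add: assoc_square[of _ n] mat_diag_def)
    also have "\<dots> = row (U\<^sup>\<dagger>) i \<bullet> col (\<rho> * U) i"
      using i U by simp
    also have "row (U\<^sup>\<dagger>) i = conjugate (col U i)"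
      by (rule eq_vecI) (use i U in auto)
    also have "col (\<rho> * U) i = \<rho> *\<^sub>v col U i"
      by (rule col_mult2[OF \<rho> U(1) i])
    finally have "Re (complex_of_real (l i)) \<ge> 0" using assms ci by (simp add: density_op_def)
    then show "0 \<le> l i" by simp
  qed
qed

lemma gibbs_state_eigen:
  fixes \<beta> :: real
  assumes d: "diagonalizes n H U h" and n: "0 < n"
  defines "Z \<equiv> \<Sum>i<n. exp (- \<beta> * h i)"
  shows "0 < Z" "diagonalizes n (gibbs_state n \<beta> H) U (\<lambda>i. exp (- \<beta> * h i) / Z)"
proof -
  note U = diagonalizes_carrier[OF d]
  show Z: "0 < Z" unfolding Z_def using n by (intro sum_pos) auto
  define D where "D = mat_diag n (\<lambda>i. complex_of_real (exp (- \<beta> * h i)))"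
  have D: "D \<in> carrier_mat n n" by (simp add: D_def)
  have E: "mat_fun n (\<lambda>x. exp (- \<beta> * x)) H = U * D * U\<^sup>\<dagger>"
    unfolding D_def by (rule mat_fun_eq[OF d])
  have tr: "mtrace (U * D * U\<^sup>\<dagger>) = complex_of_real Z"
    using mtrace_unitary_conj[OF U(4) D] by (simp add: D_def Z_def)
  have "mat_diag n (\<lambda>i. complex_of_real (exp (- \<beta> * h i) / Z)) = (1 / complex_of_real Z) \<cdot>\<^sub>m D"
    by (rule eq_matI) (auto simp: D_def mat_diag_def)
  then show "diagonalizes n (gibbs_state n \<beta> H) U (\<lambda>i. exp (- \<beta> * h i) / Z)"
    unfolding diagonalizes_def gibbs_state_def E Let_def tr using U D
    by (simp add: mult_smult_distrib[of _ n n _ n] mult_smult_assoc_mat[of _ n n _ n] mult_square[of _ n])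
qed

text \<open>The constant is the smallest Boltzmann weight. It makes the Gibbs state an admissible
  second argument of the relative entropy.\<close>

lemma gibbs_state_bounded_below:
  assumes H: "hermitian_mat n H" and n: "0 < n"
  obtains c where "0 < c" "bounded_below n c (gibbs_state n \<beta> H)"
proof -
  obtain U h where d: "diagonalizes n H U h" using spectral_theorem[OF H] .
  define p where "p i = exp (- \<beta> * h i) / (\<Sum>i<n. exp (- \<beta> * h i))" for i
  note g = gibbs_state_eigen[OF d n, of \<beta>, folded p_def]
  have "0 < Min (p ` {..<n})" using n g(1) by (subst Min_gr_iff) (auto simp: p_def)
  moreover have "bounded_below n (Min (p ` {..<n})) (gibbs_state n \<beta> H)"
    by (rule bounded_belowI[OF g(2)]) (auto intro: Min_le)
  ultimately show ?thesis using that by blast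
qed

lemma mtrace_gibbs_state:
  assumes H: "hermitian_mat n H" and n: "0 < n"
  shows "mtrace (gibbs_state n \<beta> H) = 1"
proof -
  obtain U h where d: "diagonalizes n H U h" using spectral_theorem[OF H] .
  note g = gibbs_state_eigen[OF d n, of \<beta>]
  show ?thesis using g(1) unfolding mtrace_eigen[OF g(2)] sum_divide_distrib[symmetric] by simp
qed

text \<open>The constant is -ln Z, with Z the partition function; it drops out when two states of
  trace 1 are compared.\<close>

lemma mat_ln_gibbs_state:
  assumes H: "hermitian_mat n H" and n: "0 < n"
  obtains f where "mat_ln n (gibbs_state n \<beta> H) = complex_of_real (- \<beta>) \<cdot>\<^sub>m H + complex_of_real f \<cdot>\<^sub>m 1\<^sub>m n"
proof -
  obtain U h where d: "diagonalizes n H U h" using spectral_theorem[OF H] .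
  define Z where "Z = (\<Sum>i<n. exp (- \<beta> * h i))"
  note g = gibbs_state_eigen[OF d n, of \<beta>, folded Z_def]
  have "ln (exp (- \<beta> * h i) / Z) = - \<beta> * h i + - ln Z" for i
    using g(1) by (simp add: ln_div)
  then show ?thesis
    using that[of "- ln Z"] mat_ln_eq[OF g(2)] diagonalizes_affine[OF d, of "- \<beta>" "- ln Z"] by simp
qed

text \<open>The right side minus the left side is exactly the relative entropy of
  \<open>\<rho>\<close> with respect to the Gibbs state.\<close>

lemma gibbs_variational:
  assumes H: "hermitian_mat n H" and n: "0 < n" and \<rho>: "bounded_below n 0 \<rho>" "mtrace \<rho> = 1"
  shows "vn_entropy n \<rho> - vn_entropy n (gibbs_state n \<beta> H) \<le> \<beta> * Re (mtrace ((\<rho> - gibbs_state n \<beta> H) * H))"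
proof -
  let ?g = "gibbs_state n \<beta> H"
  obtain c where c: "0 < c" "bounded_below n c ?g" using gibbs_state_bounded_below[OF H n] .
  obtain f where f: "mat_ln n ?g = complex_of_real (- \<beta>) \<cdot>\<^sub>m H + complex_of_real f \<cdot>\<^sub>m 1\<^sub>m n"
    using mat_ln_gibbs_state[OF H n] .
  have tr: "mtrace ?g = 1" by (rule mtrace_gibbs_state[OF H n])
  have Hc: "H \<in> carrier_mat n n" using H by (simp add: hermitian_mat_def)
  note gc = bounded_below_carrier[OF c(2)] and \<rho>c = bounded_below_carrier[OF \<rho>(1)]
  \<comment> \<open>Applied to \<open>\<rho>\<close> and to the Gibbs state itself, so that
    \<open>f\<close> can be eliminated.\<close>
  have e: "Re (mtrace (A * mat_ln n ?g)) = - \<beta> * Re (mtrace (A * H)) + f"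
    if A: "A \<in> carrier_mat n n" "mtrace A = 1" for A
  proof -
    have "A * mat_ln n ?g = complex_of_real (- \<beta>) \<cdot>\<^sub>m (A * H) + complex_of_real f \<cdot>\<^sub>m A"
      unfolding f using A Hc
      by (simp add: mult_add_distrib_mat[of _ n n _ n] mult_smult_distrib[of _ n n _ n] right_mult_one_mat[of _ n n])
    then show ?thesis
      using A Hc by (simp add: mtrace_add[of _ n] mtrace_smult[of _ n] mult_square[of _ n])
  qed
  have "0 \<le> rel_entropy n \<rho> ?g" by (rule rel_entropy_nonneg[OF \<rho> c(2) tr c(1) n])
  then have "vn_entropy n \<rho> \<le> \<beta> * Re (mtrace (\<rho> * H)) - f"
    using e[OF \<rho>c \<rho>(2)] by (simp add: rel_entropy_def vn_entropy_def)
  moreover have "vn_entropy n ?g = \<beta> * Re (mtrace (?g * H)) - f"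
    using e[OF gc tr] by (simp add: vn_entropy_def)
  moreover have "\<beta> * Re (mtrace ((\<rho> - ?g) * H)) = \<beta> * Re (mtrace (\<rho> * H)) - \<beta> * Re (mtrace (?g * H))"
    using \<rho>c gc Hc by (simp add: right_diff_distrib minus_mult_distrib_mat[of _ n n _ _ n] mtrace_minus[of _ n] mult_square[of _ n])
  ultimately show ?thesis by linarith
qed

theorem theorem1:
  fixes dS dM dR :: nat and \<rho>iSM HR USR :: "complex mat" and \<beta> :: real
    and \<rho>iR \<rho>fSMR \<rho>fSM \<rho>fR \<rho>fS \<rho>fM \<rho>iS \<rho>iM :: "complex mat"
    and QR \<Sigma>S \<Sigma>SM :: real
  assumes dims: "0 < dS" "0 < dM" "0 < dR"
    and rhoSM: "density_op (dS*dM) \<rho>iSM"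
    and HR: "hermitian_mat dR HR"
    and beta: "\<beta> > 0"
    and U: "unitary_mat (dS*dR) USR"
    and "\<rho>iR = gibbs_state dR \<beta> HR"
    and "\<rho>fSMR = lift_SR dS dM dR USR * kron (dS*dM) dR \<rho>iSM \<rho>iR * mat_adjoint (lift_SR dS dM dR USR)"
    and "\<rho>fSM = ptrace2 (dS*dM) dR \<rho>fSMR"
    and "\<rho>fR = ptrace1 (dS*dM) dR \<rho>fSMR"
    and "\<rho>fS = ptrace2 dS dM \<rho>fSM"
    and "\<rho>fM = ptrace1 dS dM \<rho>fSM"
    and "\<rho>iS = ptrace2 dS dM \<rho>iSM"
    and "\<rho>iM = ptrace1 dS dM \<rho>iSM"
    and "QR = Re (mtrace ((\<rho>fR - \<rho>iR) * HR))"
    and "\<Sigma>S = vn_entropy dS \<rho>fS - vn_entropy dS \<rho>iS + \<beta> * QR"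
    and "\<Sigma>SM = (vn_entropy (dS*dM) \<rho>fSM - vn_entropy dM \<rho>fM)
               - (vn_entropy (dS*dM) \<rho>iSM - vn_entropy dM \<rho>iM) + \<beta> * QR"
  shows "\<Sigma>SM \<ge> \<Sigma>S \<and> \<Sigma>S \<ge> 0"
proof -
  note defs = assms(8-18)
  let ?N = "dS * dM * dR"
  let ?L = "lift_SR dS dM dR USR"
  let ?i = "kron (dS * dM) dR \<rho>iSM \<rho>iR"
  have iSM: "bounded_below (dS * dM) 0 \<rho>iSM" "mtrace \<rho>iSM = 1" "\<rho>iSM \<in> carrier_mat (dS * dM) (dS * dM)"
    using density_op_bounded_below[OF rhoSM] rhoSM bounded_below_carrier by (auto simp: density_op_def)
  obtain c where c: "0 < c" "bounded_below dR c \<rho>iR"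
    using gibbs_state_bounded_below[OF HR dims(3)] defs(1) by blast
  have iR: "bounded_below dR 0 \<rho>iR" "mtrace \<rho>iR = 1" "\<rho>iR \<in> carrier_mat dR dR"
  proof -
    obtain V l where Vl: "diagonalizes dR \<rho>iR V l" using spectral_theorem bounded_below_hermitian[OF c(2)] by blast
    show "bounded_below dR 0 \<rho>iR"
      by (rule bounded_belowI[OF Vl]) (use bounded_below_eigenvalue[OF c(2) Vl] c(1) in fastforce)
    show "mtrace \<rho>iR = 1" using mtrace_gibbs_state[OF HR dims(3)] defs(1) by simp
  qed (rule bounded_below_carrier[OF c(2)])
  have iS: "bounded_below dS 0 \<rho>iS" "mtrace \<rho>iS = 1"
    using bounded_below_ptrace2[OF iSM(1)] mtrace_ptrace2_one[OF iSM(3)] iSM(2) defs(7) by auto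
  have uL: "unitary_mat ?N ?L" by (rule unitary_lift_SR[OF U])
  have i: "bounded_below ?N 0 ?i" by (rule bounded_below_kron[OF iSM(1) iR(1)])
  have f: "bounded_below ?N 0 \<rho>fSMR" unfolding defs(2) by (rule bounded_below_unitary_conj[OF i uL])
  note fc = bounded_below_carrier[OF f]
  define \<rho>fSR where "\<rho>fSR = ptrace_mid dS dM dR \<rho>fSMR"
  \<comment> \<open>Once the memory is traced out, system and reservoir start in a product state and
    evolve unitarily, so the entropy of this marginal is known as well.\<close>
  have fSR: "\<rho>fSR = USR * kron dS dR \<rho>iS \<rho>iR * USR\<^sup>\<dagger>"
    unfolding \<rho>fSR_def defs(2) lift_SR_conj_ptrace_mid[OF unitary_carrier[OF U] kron_carrier] ptrace_mid_kron defs(7) ..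
  have iSR: "bounded_below (dS * dR) 0 (kron dS dR \<rho>iS \<rho>iR)" by (rule bounded_below_kron[OF iS(1) iR(1)])
  have fSR_pos: "bounded_below (dS * dR) 0 \<rho>fSR" unfolding fSR by (rule bounded_below_unitary_conj[OF iSR U])
  have fSR_tr: "mtrace \<rho>fSR = 1"
    unfolding fSR using mtrace_unitary_conj[OF U kron_carrier] iS iR
    by (simp add: mtrace_kron bounded_below_carrier)
  have fS: "\<rho>fS = ptrace2 dS dR \<rho>fSR" unfolding defs(3,5) \<rho>fSR_def by (rule ptrace2_ptrace2[OF fc])
  have fR: "\<rho>fR = ptrace1 dS dR \<rho>fSR" unfolding defs(4) \<rho>fSR_def by (rule ptrace1_ptrace_mid[OF fc])
  have fR_pos: "bounded_below dR 0 \<rho>fR" and fR_tr: "mtrace \<rho>fR = 1"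
  proof -
    \<comment> \<open>With a trivial first factor \<open>ptrace1\<close> is a middle trace, for
      which the lower bound is already available.\<close>
    have 1: "\<rho>fR = ptrace_mid 1 dS dR \<rho>fSR"
      unfolding fR by (rule eq_matI) (auto simp: ptrace_mid_def ptrace1_def)
    show "bounded_below dR 0 \<rho>fR" using bounded_below_ptrace_mid[of 1 dS dR 0 \<rho>fSR] fSR_pos unfolding 1 by simp
    show "mtrace \<rho>fR = 1"
      using mtrace_ptrace1[of "1\<^sub>m dR" dR \<rho>fSR dS] bounded_below_carrier[OF fSR_pos] fSR_tr
        left_mult_one_mat[OF bounded_below_carrier[OF fSR_pos]] left_mult_one_mat[OF ptrace1_carrier]
      by (simp add: kron_one fR)
  qed
  have fM: "\<rho>fM = \<rho>iM"
    unfolding defs(2,3,6,8) ptrace_memory_invariant[OF U kron_carrier] ptrace2_kron[OF iSM(3) iR(3)] iR(2)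
    by (rule arg_cong[of _ _ "ptrace1 dS dM"]) (rule eq_matI, auto)
  have S_fSMR: "vn_entropy ?N \<rho>fSMR = vn_entropy (dS * dM) \<rho>iSM + vn_entropy dR \<rho>iR"
    unfolding defs(2) vn_entropy_unitary_conj[OF bounded_below_hermitian[OF i] uL]
    by (rule vn_entropy_kron[OF iSM(1,2) iR(1,2)])
  have S_fSR: "vn_entropy (dS * dR) \<rho>fSR = vn_entropy dS \<rho>iS + vn_entropy dR \<rho>iR"
    unfolding fSR vn_entropy_unitary_conj[OF bounded_below_hermitian[OF iSR] U]
    by (rule vn_entropy_kron[OF iS iR(1,2)])
  have "vn_entropy ?N \<rho>fSMR + vn_entropy dS \<rho>fS \<le> vn_entropy (dS * dM) \<rho>fSM + vn_entropy (dS * dR) \<rho>fSR"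
    using strong_subadditivity[OF f dims(2,3)] unfolding fS defs(3) \<rho>fSR_def .
  \<comment> \<open>The initial reservoir entropy occurs in both joint entropies and cancels, as do
    the memory entropies and the heat terms.\<close>
  then have "\<Sigma>S \<le> \<Sigma>SM" unfolding defs(10,11) fM S_fSMR S_fSR by simp
  \<comment> \<open>Subadditivity bounds the system's entropy loss by the reservoir's entropy gain,
    and the Gibbs principle bounds that gain by \<open>\<beta> * QR\<close>.\<close>
  moreover have "vn_entropy (dS * dR) \<rho>fSR \<le> vn_entropy dS \<rho>fS + vn_entropy dR \<rho>fR"
    unfolding fS fR by (rule subadditivity[OF fSR_pos fSR_tr dims(1,3)])
  moreover have "vn_entropy dR \<rho>fR - vn_entropy dR \<rho>iR \<le> \<beta> * QR"
    unfolding defs(9) unfolding defs(1) by (rule gibbs_variational[OF HR dims(3) fR_pos fR_tr])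
  ultimately show ?thesis unfolding defs(10) S_fSR by simp
qed

end
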